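(* Let $H$ be a cyclic subgroup of a free group $F$, and let $\mathbf{S}$ be the pseudovariety of all finite solvable groups. Then: (i) $H$ is $\mathbf{S}$-closed; (ii) $H$ is a free factor of an $\mathbf{S}$-clopen subgroup of $F$.
   Context: A pseudovariety of finite groups is a class of finite groups closed under taking subgroups, homomorphic images and finitary direct products. For a pseudovariety $\mathbf{V}$, the pro-$\mathbf{V}$ topology on a group $G$ is the coarsest topology making all homomorphisms from $G$ into (discrete) members of $\mathbf{V}$ continuous; equivalently, $G$ is a topological group in which the normal subgroups $K$ with $G/K \in \mathbf{V}$ form a basis of neighbourhoods of the identity. "$\mathbf{V}$-closed" and "$\mathbf{V}$-clopen" mean closed, respectively both closed and open, in the pro-$\mathbf{V}$ topology on $F$. *)

theory Defs
  imports "HOL-Algebra.Elementary_Groups" "HOL-Algebra.Solvable_Groups" "HOL-Analysis.Function_Topology"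
begin

definition group_list_prod :: "('a, 'b) monoid_scheme \<Rightarrow> 'a list \<Rightarrow> 'a" where
  "group_list_prod G xs = foldr (\<otimes>\<^bsub>G\<^esub>) xs \<one>\<^bsub>G\<^esub>"

text \<open>Free groups. The letter \<open>(x, True)\<close> stands for \<open>x\<close> and \<open>(x, False)\<close> for its formal inverse.
  The reduced words over \<open>X\<close> are the elements of the free group on \<open>X\<close>, and \<open>X\<close> is a free basis
  of \<open>G\<close> if the canonical evaluation map from the free group on \<open>X\<close> to \<open>G\<close> is bijective.
  The basis may be infinite or empty.\<close>

definition reduced_words :: "'a set \<Rightarrow> ('a \<times> bool) list set" where
  "reduced_words X =
     {w. fst ` set w \<subseteq> X \<and> successively (\<lambda>(x, b) (y, c). \<not> (x = y \<and> b \<noteq> c)) w}"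

definition word_value :: "('a, 'b) monoid_scheme \<Rightarrow> ('a \<times> bool) list \<Rightarrow> 'a" where
  "word_value G w = group_list_prod G (map (\<lambda>(x, b). if b then x else inv\<^bsub>G\<^esub> x) w)"

definition free_basis :: "('a, 'b) monoid_scheme \<Rightarrow> 'a set \<Rightarrow> bool" where
  "free_basis G X \<longleftrightarrow>
     X \<subseteq> carrier G \<and> bij_betw (word_value G) (reduced_words X) (carrier G)"

definition is_free_group :: "('a, 'b) monoid_scheme \<Rightarrow> bool" where
  "is_free_group G \<longleftrightarrow> group G \<and> (\<exists>X. free_basis G X)"

text \<open>Free products. Syllables carry a tag recording the factor they come from (\<open>True\<close> for the
  first one), so that the two factors are treated as disjoint even if they overlap inside the
  ambient group. The words below are the elements of the external free product of \<open>H\<close> and \<open>L\<close>;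
  \<open>K\<close> is the internal free product if the canonical map from it to the ambient group is
  a bijection onto \<open>K\<close>.\<close>

definition free_product_words ::
    "('a, 'b) monoid_scheme \<Rightarrow> 'a set \<Rightarrow> 'a set \<Rightarrow> (bool \<times> 'a) list set" where
  "free_product_words G H L =
     {w. (\<forall>(t, x) \<in> set w. x \<in> (if t then H else L) - {\<one>\<^bsub>G\<^esub>}) \<and>
         successively (\<lambda>u v. fst u \<noteq> fst v) w}"

definition internal_free_product ::
    "('a, 'b) monoid_scheme \<Rightarrow> 'a set \<Rightarrow> 'a set \<Rightarrow> 'a set \<Rightarrow> bool" where
  "internal_free_product G H L K \<longleftrightarrow>
     subgroup H G \<and> subgroup L G \<and> subgroup K G \<and>
     bij_betw (\<lambda>w. group_list_prod G (map snd w)) (free_product_words G H L) K"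

definition free_factor :: "('a, 'b) monoid_scheme \<Rightarrow> 'a set \<Rightarrow> 'a set \<Rightarrow> bool" where
  "free_factor G H K \<longleftrightarrow> (\<exists>L. internal_free_product G H L K)"

text \<open>The coarsest topology on \<open>G\<close> making all homomorphisms into discrete members of \<open>V\<close> continuous.\<close>

definition pro_topology :: "'c monoid set \<Rightarrow> ('a, 'b) monoid_scheme \<Rightarrow> 'a topology" where
  "pro_topology V G =
     topology_generated_by
       {f -` A \<inter> carrier G | f A Q. Q \<in> V \<and> f \<in> hom G Q \<and> A \<subseteq> carrier Q}"

text \<open>Every finite group is isomorphic to one whose elements are natural numbers, and the pro-\<open>V\<close>
  topology depends only on the isomorphism types in \<open>V\<close>. So no finite solvable quotient is lost by
  fixing the element type \<open>nat\<close>.\<close>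

definition finite_solvable_groups :: "nat monoid set" where
  "finite_solvable_groups = {Q. group Q \<and> finite (carrier Q) \<and> solvable Q}"

end

(*
  Separating a cyclic subgroup H = <h> from g in F: if g and h do not commute, a finite solvable
  quotient in which their commutator survives does it. If they commute, both are powers of a
  common element z, say g = z^k and h = z^m with m not dividing k, and one needs a finite solvable
  quotient in which z has order divisible by m. Both quotients come from unitriangular integer
  representations reduced modulo a suitable number.

  Since H is closed, some clopen subgroup K containing H separates the finitely many proper prefixes
  of a cyclically reduced word for h, so that h labels a simple cycle in the Schreier graph of K.
  Removing one edge of this cycle leaves a connected graph whose loops form a complement of H in K,
  by a ping-pong argument on the first passage of a reduced path through that edge.
*)

theory Submission
  imports Defs "HOL-Algebra.Zassenhaus" "HOL-Number_Theory.Cong"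
begin

section \<open>Words\<close>

text \<open>\<open>F\<close> may have infinite rank, so no single representation is reduced: each
  nontrivial element gets its own, built from its syllables, in which the basis elements that do not
  occur there act trivially. Residual solvability alone would only keep \<open>z\<close> nontrivial,
  while its order has to be a multiple of a prescribed m. Integer entries give this: the powers of
  \<open>z\<close> move some coordinate by multiples of a fixed nonzero step, and the modulus is
  chosen after m. Unitriangularity bounds the derived length before any reduction; the reduction
  makes the index finite.

  For the free factor, a word that is not cyclically reduced would label a cycle with a tail.
  Conjugating the basis instead of h removes the tail, and this is harmless because neither the
  topology nor free factors refer to a basis. The cycle has to be simple so that the path
  \<open>p\<close> from the base point to the removed edge does not cross that edge itself:
  \<open>p\<close> then serves to close up the pieces of a loop between two crossings.\<close>

definition inv_letter :: "'a \<times> bool \<Rightarrow> 'a \<times> bool" where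
  "inv_letter a = (fst a, \<not> snd a)"

definition inv_word :: "('a \<times> bool) list \<Rightarrow> ('a \<times> bool) list" where
  "inv_word w = rev (map inv_letter w)"

definition reduced :: "('a \<times> bool) list \<Rightarrow> bool" where
  "reduced = successively (\<lambda>a b. b \<noteq> inv_letter a)"

fun reduce :: "('a \<times> bool) list \<Rightarrow> ('a \<times> bool) list" where
  "reduce [] = []"
| "reduce (a # w) =
     (case reduce w of [] \<Rightarrow> [a] | b # v \<Rightarrow> if b = inv_letter a then v else a # b # v)"

lemma inv_letter_inv_letter [simp]: "inv_letter (inv_letter a) = a"
  by (simp add: inv_letter_def)

lemma inv_letter_neq [simp]: "inv_letter a \<noteq> a" "a \<noteq> inv_letter a"
  by (auto simp: inv_letter_def prod_eq_iff)

lemma inv_letter_eq_iff: "inv_letter a = b \<longleftrightarrow> a = inv_letter b"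
  by auto

lemma inv_letter_in_iff [simp]: "inv_letter a \<in> X \<times> UNIV \<longleftrightarrow> a \<in> X \<times> UNIV"
  by (cases a) (simp add: inv_letter_def)

lemma inv_word_simps [simp]:
  "inv_word [] = []" "inv_word (a # w) = inv_word w @ [inv_letter a]"
  "inv_word (v @ w) = inv_word w @ inv_word v" "inv_word (inv_word w) = w"
  "inv_word w = [] \<longleftrightarrow> w = []" "length (inv_word w) = length w"
  by (auto simp: inv_word_def rev_map o_def)

lemma set_inv_word [simp]: "set (inv_word w) \<subseteq> X \<times> UNIV \<longleftrightarrow> set w \<subseteq> X \<times> UNIV"
  by (induction w) auto

lemma reduced_Nil [simp]: "reduced []"
  by (simp add: reduced_def)

lemma reduced_Cons: "reduced (a # w) \<longleftrightarrow> w = [] \<or> hd w \<noteq> inv_letter a \<and> reduced w"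
  by (simp add: reduced_def successively_Cons)

lemma reduced_append:
  "reduced (v @ w) \<longleftrightarrow>
     reduced v \<and> reduced w \<and> (v = [] \<or> w = [] \<or> hd w \<noteq> inv_letter (last v))"
  by (auto simp: reduced_def successively_append_iff)

lemma reduced_inv_word: "reduced w \<Longrightarrow> reduced (inv_word w)"
  by (auto simp: reduced_def inv_word_def successively_map elim!: successively_mono)

lemma reduced_words_iff: "w \<in> reduced_words X \<longleftrightarrow> reduced w \<and> set w \<subseteq> X \<times> UNIV"
proof -
  have "(\<lambda>(x, b) (y, c). \<not> (x = y \<and> b \<noteq> c)) = (\<lambda>a b. b \<noteq> inv_letter (a :: 'a \<times> bool))"
    by (auto simp: fun_eq_iff inv_letter_def)
  then show ?thesis
    by (auto simp: reduced_words_def reduced_def)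
qed

lemma reduced_reduce: "reduced (reduce w)"
  by (induction w) (auto simp: reduced_Cons split: list.split)

lemma set_reduce: "set (reduce w) \<subseteq> set w"
  by (induction w) (auto split: list.split)

text \<open>\<open>c\<close> is the maximal part of \<open>u\<close> that cancels against
  \<open>v\<close>. The induction takes letters off the end of \<open>u\<close> as long as they
  cancel the head of \<open>v\<close>.\<close>

lemma reduced_cancellation:
  assumes "reduced u" "reduced v"
  obtains u' c v' where "u = u' @ c" "v = inv_word c @ v'" "reduced (u' @ v')"
  using assms
proof (induction u arbitrary: v thesis rule: rev_induct)
  case Nil
  show ?case by (rule Nil(1)[of "[]" "[]" v]) (use Nil in auto)
next
  case (snoc a u)
  show ?case
  proof (cases "v \<noteq> [] \<and> hd v = inv_letter a")
    case True
    then obtain v0 where v: "v = inv_letter a # v0"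
      by (cases v) auto
    then have "reduced v0" "reduced u"
      using snoc.prems by (auto simp: reduced_Cons reduced_append)
    then obtain u' c v' where "u = u' @ c" "v0 = inv_word c @ v'" "reduced (u' @ v')"
      using snoc.IH by metis
    then show ?thesis
      using v by (intro snoc.prems(1)[of u' "c @ [a]" v']) auto
  next
    case False
    then have "reduced ((u @ [a]) @ v)"
      using snoc.prems by (subst reduced_append) auto
    then show ?thesis
      by (intro snoc.prems(1)[of "u @ [a]" "[]" v]) auto
  qed
qed

section \<open>Cyclically reduced words and their powers\<close>

definition cyclically_reduced :: "('a \<times> bool) list \<Rightarrow> bool" where
  "cyclically_reduced w \<longleftrightarrow> w \<noteq> [] \<and> reduced w \<and> hd w \<noteq> inv_letter (last w)"

definition word_power :: "('a \<times> bool) list \<Rightarrow> nat \<Rightarrow> ('a \<times> bool) list" where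
  "word_power w n = concat (replicate n w)"

lemma word_power_simps [simp]:
  "word_power w 0 = []" "word_power w (Suc n) = w @ word_power w n"
  by (simp_all add: word_power_def)

lemma word_power_Suc2: "word_power w (Suc n) = word_power w n @ w"
  by (induction n) auto

lemma length_word_power [simp]: "length (word_power w n) = n * length w"
  by (induction n) auto

lemma set_word_power: "set (word_power w n) \<subseteq> set w"
  by (induction n) auto

lemma reduced_word_power_append:
  assumes "cyclically_reduced w" "reduced v" "v = [] \<or> hd v \<noteq> inv_letter (last w)"
  shows "reduced (word_power w n @ v)"
proof -
  \<comment> \<open>The condition on the head joins the induction because it is what makes the
    junction with a further copy of \<open>w\<close> reduced.\<close>
  have "reduced (word_power w n @ v) \<and>
      (word_power w n @ v = [] \<or> hd (word_power w n @ v) \<noteq> inv_letter (last w))"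
    using assms by (induction n) (auto simp: reduced_append cyclically_reduced_def hd_append)
  then show ?thesis by blast
qed

lemma reduced_word_power: "cyclically_reduced w \<Longrightarrow> reduced (word_power w n)"
  using reduced_word_power_append[of w "[]" n] by simp

section \<open>Values of words in a group\<close>

definition letter_value :: "('a, 'b) monoid_scheme \<Rightarrow> 'a \<times> bool \<Rightarrow> 'a" where
  "letter_value G a = (if snd a then fst a else inv\<^bsub>G\<^esub> (fst a))"

lemma word_value_simps [simp]:
  "word_value G [] = \<one>\<^bsub>G\<^esub>" "word_value G (a # w) = letter_value G a \<otimes>\<^bsub>G\<^esub> word_value G w"
  by (simp_all add: word_value_def group_list_prod_def letter_value_def case_prod_beta)

context group
begin

lemma letter_value_closed: "X \<subseteq> carrier G \<Longrightarrow> a \<in> X \<times> UNIV \<Longrightarrow> letter_value G a \<in> carrier G"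
  by (auto simp: letter_value_def)

lemma word_value_closed: "X \<subseteq> carrier G \<Longrightarrow> set w \<subseteq> X \<times> UNIV \<Longrightarrow> word_value G w \<in> carrier G"
  by (induction w) (auto simp: letter_value_closed)

lemma word_value_append:
  assumes "X \<subseteq> carrier G" "set v \<subseteq> X \<times> UNIV" "set w \<subseteq> X \<times> UNIV"
  shows "word_value G (v @ w) = word_value G v \<otimes> word_value G w"
  using assms(2)
  by (induction v)
     (use assms in \<open>auto simp: letter_value_closed[OF assms(1)] word_value_closed[OF assms(1)] m_assoc\<close>)

lemma letter_value_inv:
  "X \<subseteq> carrier G \<Longrightarrow> a \<in> X \<times> UNIV \<Longrightarrow> letter_value G (inv_letter a) = inv (letter_value G a)"
  by (auto simp: letter_value_def inv_letter_def)

lemma word_value_inv_word: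
  assumes "X \<subseteq> carrier G" "set w \<subseteq> X \<times> UNIV"
  shows "word_value G (inv_word w) = inv (word_value G w)"
  using assms(2)
proof (induction w)
  case (Cons a w)
  then have "word_value G (inv_word (a # w)) = inv (word_value G w) \<otimes> inv (letter_value G a)"
    using assms(1) word_value_append[of X "inv_word w" "[inv_letter a]"]
    by (simp add: letter_value_inv letter_value_closed)
  then show ?case
    using Cons.prems assms(1) letter_value_closed[of X a] word_value_closed[of X w]
    by (simp add: inv_mult_group)
qed simp

lemma word_value_reduce:
  assumes "X \<subseteq> carrier G" "set w \<subseteq> X \<times> UNIV"
  shows "word_value G (reduce w) = word_value G w"
  using assms(2)
proof (induction w)
  case (Cons a w)
  then have IH: "word_value G (reduce w) = word_value G w" and a: "a \<in> X \<times> UNIV"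
    by auto
  have "set (reduce w) \<subseteq> X \<times> UNIV"
    using Cons.prems set_reduce[of w] by auto
  then show ?case
    using IH[symmetric] a assms(1) letter_value_closed[OF assms(1) a] word_value_closed[OF assms(1)]
    by (auto simp: letter_value_inv m_assoc[symmetric] split: list.split)
qed simp

end

lemma (in group_hom) hom_word_value:
  assumes "X \<subseteq> carrier G" "set w \<subseteq> X \<times> UNIV"
  shows "word_value H (map (apfst h) w) = h (word_value G w)"
  using assms(2)
proof (induction w)
  case (Cons a w)
  then have "letter_value H (apfst h a) = h (letter_value G a)"
    using assms(1) by (auto simp: letter_value_def)
  then show ?case
    using Cons assms(1) G.word_value_closed[of X w] G.letter_value_closed[of X a] by simp
qed simp

text \<open>Renaming letters along \<phi> is injective on \<open>X\<close> and so preserves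
  reducedness. It is used for inner automorphisms, to trade the conjugation of an element for a
  change of basis.\<close>

lemma free_basis_iso:
  assumes "group G" "group H" "\<phi> \<in> iso G H" "free_basis G X"
  shows "free_basis H (\<phi> ` X)"
proof -
  interpret group_hom G H \<phi>
    using assms by (simp add: group_hom_def group_hom_axioms_def iso_def)
  have X: "X \<subseteq> carrier G" and bij: "bij_betw (word_value G) (reduced_words X) (carrier G)"
    using assms(4) by (auto simp: free_basis_def)
  have \<phi>: "bij_betw \<phi> (carrier G) (carrier H)"
    using assms(3) by (simp add: iso_def)
  then have inj: "inj_on \<phi> X"
    using X by (meson bij_betw_def inj_on_subset)
  let ?m = "map (apfst \<phi>) :: ('a \<times> bool) list \<Rightarrow> ('c \<times> bool) list"
  have red: "reduced (?m w) \<longleftrightarrow> reduced w" if "set w \<subseteq> X \<times> UNIV" for w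
    unfolding reduced_def successively_map
    by (rule successively_cong[OF _ refl])
       (use that inj_onD[OF inj] in \<open>auto simp: inv_letter_def apfst_def subset_iff; blast\<close>)
  have "bij_betw ?m (reduced_words X) (reduced_words (\<phi> ` X))"
  proof (rule bij_betwI')
    fix v w assume vw: "v \<in> reduced_words X" "w \<in> reduced_words X"
    have "inj_on (apfst \<phi>) (X \<times> (UNIV :: bool set))"
      using inj by (auto simp: inj_on_def)
    then have "inj_on (apfst \<phi>) (set v \<union> set w)"
      using vw by (metis Un_least inj_on_subset reduced_words_iff)
    then show "?m v = ?m w \<longleftrightarrow> v = w"
      by (simp add: inj_on_map_eq_map)
  next
    fix v assume "v \<in> reduced_words X"
    then show "?m v \<in> reduced_words (\<phi> ` X)"
      by (auto simp: reduced_words_iff red)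
  next
    fix v assume v: "v \<in> reduced_words (\<phi> ` X)"
    let ?u = "map (apfst (inv_into X \<phi>)) v"
    have u: "set ?u \<subseteq> X \<times> UNIV"
      using v by (auto simp: reduced_words_iff inv_into_into subset_iff)
    moreover have eq: "?m ?u = v"
      using v by (auto simp: reduced_words_iff o_def f_inv_into_f subset_iff intro!: map_idI)
    ultimately show "\<exists>u \<in> reduced_words X. v = ?m u"
      using v red[OF u] by (metis reduced_words_iff)
  qed
  moreover have "bij_betw (word_value H \<circ> ?m) (reduced_words X) (carrier H)"
  proof -
    have "bij_betw (\<phi> \<circ> word_value G) (reduced_words X) (carrier H)"
      using bij \<phi> by (rule bij_betw_trans)
    then show ?thesis
      by (rule bij_betw_cong[THEN iffD1, rotated])
         (use X in \<open>auto simp: hom_word_value reduced_words_iff\<close>)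
  qed
  \<comment> \<open>Renaming is a bijection of reduced words, and so is renaming followed by
    evaluation in \<open>H\<close>; hence evaluation in \<open>H\<close> is bijective.\<close>
  ultimately have "bij_betw (word_value H) (reduced_words (\<phi> ` X)) (carrier H)"
    using bij_betw_comp_iff by blast
  then show ?thesis
    using X by (auto simp: free_basis_def)
qed

section \<open>Free groups\<close>

locale free_group = group F for F :: "('a, 'b) monoid_scheme" (structure) +
  fixes X :: "'a set"
  assumes basis: "free_basis F X"
begin

abbreviation "val \<equiv> word_value F"

abbreviation "is_word w \<equiv> set w \<subseteq> X \<times> (UNIV :: bool set)"

definition rword :: "'a \<Rightarrow> ('a \<times> bool) list" where
  "rword = the_inv_into (reduced_words X) val"

lemma basis_carrier: "X \<subseteq> carrier F"
  using basis by (simp add: free_basis_def)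

lemmas val_closed [simp] = word_value_closed[OF basis_carrier]
lemmas val_append = word_value_append[OF basis_carrier]
lemmas val_inv_word = word_value_inv_word[OF basis_carrier]
lemmas val_reduce = word_value_reduce[OF basis_carrier]

lemma rword:
  assumes "g \<in> carrier F"
  shows "reduced (rword g)" "is_word (rword g)" "val (rword g) = g"
proof -
  have bij: "inj_on val (reduced_words X)" "g \<in> val ` reduced_words X"
    using basis assms by (auto simp: free_basis_def bij_betw_def)
  have "rword g \<in> reduced_words X"
    unfolding rword_def using bij by (rule the_inv_into_into) simp
  then show "reduced (rword g)" "is_word (rword g)"
    by (auto simp: reduced_words_iff)
  show "val (rword g) = g"
    unfolding rword_def using bij by (rule f_the_inv_into_f)
qed

lemma rword_val: "reduced w \<Longrightarrow> is_word w \<Longrightarrow> rword (val w) = w"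
  using basis by (simp add: rword_def free_basis_def bij_betw_def the_inv_into_f_f reduced_words_iff)

lemma rword_val_reduce: "is_word w \<Longrightarrow> rword (val w) = reduce w"
  by (metis val_reduce reduced_reduce rword_val set_reduce subset_trans)

lemma rword_one [simp]: "rword \<one> = []"
  using rword_val[of "[]"] by simp

section \<open>Commuting elements have a common root\<close>

lemma val_word_power: "is_word w \<Longrightarrow> val (word_power w n) = val w [^] n"
proof (induction n)
  case (Suc n)
  then show ?case
    using val_append[of "word_power w n" w] set_word_power[of w n]
    unfolding word_power_Suc2 by auto
qed auto

lemma val_cancellation:
  assumes "is_word (u @ c)" "is_word (inv_word c @ v)"
  shows "val (u @ v) = val (u @ c) \<otimes> val (inv_word c @ v)"
proof -
  have w: "is_word u" "is_word c" "is_word v"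
    using assms by auto
  have "val c \<otimes> (inv (val c) \<otimes> val v) = val v"
    using w by (simp add: m_assoc[symmetric])
  then show ?thesis
    using w by (simp add: val_append val_inv_word m_assoc)
qed

text \<open>The word of \<open>g\<close> may cancel against \<open>w\<close> on either side, so
  \<open>g\<close> is replaced by its product with a high power of \<open>val w\<close>. The reduced
  word \<open>U\<close> of the product begins and ends with \<open>w\<close>, hence commutes with
  \<open>w\<close> already as a word, and the combinatorics of words applies.\<close>

lemma commute_imp_common_root_cyclically_reduced:
  assumes w: "cyclically_reduced w" "is_word w"
    and g: "g \<in> carrier F" "g \<otimes> val w = val w \<otimes> g"
  shows "\<exists>z \<in> carrier F. \<exists>(k::int) (m::int). g = z [^] k \<and> val w = z [^] m"
proof -
  define r where "r = rword g"
  define h where "h = val w"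
  \<comment> \<open>Cancellation against \<open>r\<close> consumes at most \<open>length r\<close>
    letters of \<open>a\<close>, so this exponent leaves a full copy of \<open>w\<close> at the
    outer end, whichever side \<open>r\<close> stands on.\<close>
  define N where "N = Suc (length r)"
  define a where "a = word_power w N"
  have r: "reduced r" "is_word r" "val r = g"
    using rword g by (auto simp: r_def)
  have h [simp]: "h \<in> carrier F"
    using w by (simp add: h_def)
  have a: "reduced a" "is_word a" "val a = h [^] N"
    using w reduced_word_power set_word_power[of w N] by (auto simp: a_def h_def val_word_power)
  have comm: "g \<otimes> h [^] N = h [^] N \<otimes> g"
    using group_commutes_pow[of h g N] g(2)[folded h_def] g(1) h by simp
  obtain a1 c b1 where c: "a = a1 @ c" "r = inv_word c @ b1" "reduced (a1 @ b1)"
    by (rule reduced_cancellation[OF a(1) r(1)])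
  obtain a2 d b2 where d: "r = a2 @ d" "a = inv_word d @ b2" "reduced (a2 @ b2)"
    by (rule reduced_cancellation[OF r(1) a(1)])
  have "val (a1 @ b1) = h [^] N \<otimes> g"
    using val_cancellation[of a1 c b1] a r c by simp
  moreover have "val (a2 @ b2) = g \<otimes> h [^] N"
    using val_cancellation[of a2 d b2] a r d by simp
  moreover have "is_word (a1 @ b1)"
    using a(2) r(2) unfolding c(1,2) by simp
  moreover have "is_word (a2 @ b2)"
    using a(2) r(2) unfolding d(1,2) by simp
  ultimately have U: "a1 @ b1 = a2 @ b2"
    using comm c(3) d(3) rword_val by metis
  define U where "U = a1 @ b1"
  have len: "length w \<ge> 1"
    using w(1) by (cases w) (auto simp: cyclically_reduced_def)
  have "length a = length w + length r * length w"
    by (simp add: a_def N_def)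
  then have la: "length w + length r \<le> length a"
    using len by simp
  have "length c \<le> length r" "length d \<le> length r"
    using arg_cong[OF c(2), of length] arg_cong[OF d(1), of length] by auto
  then have l1: "length w \<le> length a1" and l2: "length w \<le> length b2"
    using la arg_cong[OF c(1), of length] arg_cong[OF d(2), of length] by auto
  have "w @ word_power w (length r) = a1 @ c"
    using c(1) by (simp add: a_def N_def)
  then obtain s1 where s1: "a1 = w @ s1"
    using l1 by (auto simp: append_eq_append_conv2)
  have "word_power w (length r) @ w = inv_word d @ b2"
    using d(2) unfolding a_def N_def word_power_Suc2 .
  then obtain s2 where s2: "b2 = s2 @ w"
    using l2 by (auto simp: append_eq_append_conv2)
  have "w \<noteq> []"
    using len by auto
  have Uw: "reduced U" "is_word U"
    using c(3) \<open>is_word (a1 @ b1)\<close> unfolding U_def by blast+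
  have hdU: "hd U = hd w" "U \<noteq> []"
    using \<open>w \<noteq> []\<close> by (simp_all add: U_def s1)
  have lastU: "last U = last w"
    using \<open>w \<noteq> []\<close> by (simp add: U_def U s2)
  \<comment> \<open>Both sides are reduced, since \<open>U\<close> has the first and the last letter
    of the cyclically reduced \<open>w\<close>; they have the same value, so they agree as
    words.\<close>
  have "w @ U = U @ w"
  proof -
    have "reduced (w @ U)" "reduced (U @ w)" "is_word (w @ U)" "is_word (U @ w)"
      using Uw hdU lastU w by (simp_all add: reduced_append cyclically_reduced_def)
    moreover have "val (w @ U) = val (U @ w)"
    proof -
      have "val U = g \<otimes> h [^] N"
        using \<open>val (a2 @ b2) = _\<close> U by (simp add: U_def)
      moreover have "h \<otimes> (g \<otimes> h [^] N) = g \<otimes> h [^] N \<otimes> h"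
        using g h unfolding h_def[symmetric]
        by (metis m_assoc nat_pow_closed nat_pow_Suc nat_pow_Suc2)
      ultimately show ?thesis
        using Uw w by (simp add: val_append h_def)
    qed
    ultimately show ?thesis
      using rword_val by metis
  qed
  then obtain m n z0 where z0: "word_power z0 m = w" "word_power z0 n = U"
    unfolding word_power_def using comm_append_are_replicate by metis
  have "is_word z0"
  proof -
    have "m \<noteq> 0" using z0(1) len by (cases m) auto
    then have "set z0 \<subseteq> set w"
      using z0(1) by (cases m) auto
    then show ?thesis using w by blast
  qed
  define z where "z = val z0"
  have z: "z \<in> carrier F" "h = z [^] m" "val U = z [^] n"
    using \<open>is_word z0\<close> z0 val_word_power by (auto simp: z_def h_def)
  have "g = val U \<otimes> inv (h [^] N)"
    using \<open>val (a2 @ b2) = _\<close> U g(1) by (simp add: U_def m_assoc)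
  also have "\<dots> = z [^] (int n - int (m * N))"
    using z by (simp add: int_pow_diff nat_pow_pow int_pow_int del: of_nat_mult)
  finally have "g = z [^] (int n - int (m * N))" .
  moreover have "val w = z [^] int m"
    using z(2) by (simp add: h_def int_pow_int)
  ultimately show ?thesis
    using z(1) by blast
qed

lemma conjugate_cyclically_reduced:
  assumes "reduced w" "is_word w" "w \<noteq> []"
  shows "\<exists>u v. u \<in> carrier F \<and> cyclically_reduced v \<and> is_word v \<and> val w = u \<otimes> val v \<otimes> inv u"
  using assms
proof (induction "length w" arbitrary: w rule: less_induct)
  case less
  show ?case
  proof (cases "cyclically_reduced w")
    case True
    then show ?thesis
      using less.prems by (intro exI[of _ \<one>] exI[of _ w]) auto
  next
    case False
    then have eq: "hd w = inv_letter (last w)"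
      using less.prems by (simp add: cyclically_reduced_def)
    obtain a w1 where w1: "w = a # w1"
      using less.prems(3) by (cases w) auto
    with eq have "w1 \<noteq> []"
      by auto
    then obtain w2 where "w1 = w2 @ [inv_letter a]"
      using eq w1 by (metis append_butlast_last_id inv_letter_inv_letter last_ConsR list.sel(1))
    with w1 have w2: "w = a # w2 @ [inv_letter a]"
      by simp
    \<comment> \<open>An empty \<open>w2\<close> would leave \<open>[a, inv_letter a]\<close>, which
      is not reduced.\<close>
    then have "w2 \<noteq> []" "reduced w2" "is_word w2" "a \<in> X \<times> UNIV"
      using less.prems by (auto simp: reduced_Cons reduced_append)
    with less.hyps[of w2] w2 obtain u v where uv: "u \<in> carrier F" "cyclically_reduced v" "is_word v"
        "val w2 = u \<otimes> val v \<otimes> inv u"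
      by auto
    have a: "letter_value F a \<in> carrier F"
      using \<open>a \<in> X \<times> UNIV\<close> basis_carrier letter_value_closed by blast
    have "val w = letter_value F a \<otimes> (val w2 \<otimes> inv (letter_value F a))"
      using \<open>is_word w2\<close> \<open>a \<in> X \<times> UNIV\<close> a w2 val_append[of w2 "[inv_letter a]"]
      by (simp add: letter_value_inv[OF basis_carrier])
    also have "\<dots> = (letter_value F a \<otimes> u) \<otimes> val v \<otimes> inv (letter_value F a \<otimes> u)"
      using uv a by (simp add: inv_mult_group m_assoc)
    finally show ?thesis
      using uv a by blast
  qed
qed

end

lemma (in group) conjugation_iso:
  assumes "u \<in> carrier G"
  shows "(\<lambda>x. u \<otimes> x \<otimes> inv u) \<in> iso G G"
proof (rule isoI)
    show "(\<lambda>x. u \<otimes> x \<otimes> inv u) \<in> hom G G"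
      using assms by (auto simp: hom_def m_assoc) (metis inv_closed l_inv l_one m_assoc m_closed)
    show "bij_betw (\<lambda>x. u \<otimes> x \<otimes> inv u) (carrier G) (carrier G)"
    proof (rule bij_betw_byWitness[where f' = "\<lambda>x. inv u \<otimes> x \<otimes> u"])
      show "\<forall>x \<in> carrier G. inv u \<otimes> (u \<otimes> x \<otimes> inv u) \<otimes> u = x"
        using assms by (metis inv_closed l_inv l_one m_assoc m_closed r_one)
      show "\<forall>x \<in> carrier G. u \<otimes> (inv u \<otimes> x \<otimes> u) \<otimes> inv u = x"
        using assms by (metis inv_closed r_inv l_one m_assoc m_closed r_one)
    qed (use assms in auto)
qed

text \<open>Conjugating the basis rather than the element makes every nontrivial element cyclically
  reduced.\<close>

lemma (in free_group) cyclically_reduced_basis: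
  assumes "h \<in> carrier F" "h \<noteq> \<one>"
  shows "\<exists>Y w. free_basis F Y \<and> cyclically_reduced w \<and> set w \<subseteq> Y \<times> UNIV \<and> h = val w"
proof -
  have "rword h \<noteq> []"
    using rword(3)[OF assms(1)] assms(2) by auto
  then obtain u v where uv: "u \<in> carrier F" "cyclically_reduced v" "is_word v"
      "h = u \<otimes> val v \<otimes> inv u"
    using conjugate_cyclically_reduced[of "rword h"] rword[OF assms(1)] by auto
  define \<phi> where "\<phi> = (\<lambda>x. u \<otimes> x \<otimes> inv u)"
  have iso: "\<phi> \<in> iso F F"
    unfolding \<phi>_def using conjugation_iso uv(1) by blast
  interpret group_hom F F \<phi>
    using iso by (simp add: group_hom_def group_hom_axioms_def iso_def)
  have "inj_on \<phi> X"
    using iso basis_carrier by (auto simp: iso_def bij_betw_def elim: inj_on_subset)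
  then have inj: "apfst \<phi> a = inv_letter (apfst \<phi> b) \<longleftrightarrow> a = inv_letter b"
    if "a \<in> X \<times> UNIV" "b \<in> X \<times> UNIV" for a b
    using that by (auto simp: inv_letter_def inj_on_def apfst_def)
  have "cyclically_reduced (map (apfst \<phi>) v)"
  proof -
    have "reduced (map (apfst \<phi>) v)"
      unfolding reduced_def successively_map
      by (rule successively_mono[of "\<lambda>a b. b \<noteq> inv_letter a"])
         (use uv(2) inj[OF subsetD[OF uv(3)] subsetD[OF uv(3)]] in
           \<open>auto simp: cyclically_reduced_def reduced_def\<close>)
    moreover have "hd v \<in> X \<times> UNIV" "last v \<in> X \<times> UNIV"
      using uv(2,3) by (auto simp: cyclically_reduced_def intro!: subsetD[OF uv(3)])
    ultimately show ?thesis
      using uv(2) by (simp add: cyclically_reduced_def hd_map last_map inj)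
  qed
  moreover have "val (map (apfst \<phi>) v) = h"
    using hom_word_value[OF basis_carrier uv(3)] uv(4) by (simp add: \<phi>_def)
  moreover have "set (map (apfst \<phi>) v) \<subseteq> \<phi> ` X \<times> UNIV"
    using uv(3) by auto
  ultimately show ?thesis
    using free_basis_iso[OF is_group is_group iso basis] by metis
qed

text \<open>The conclusion does not mention the basis, so a basis that makes \<open>h\<close>
  cyclically reduced may be used. Only \<open>h = \<one>\<close> has no such basis; there
  \<open>g\<close> itself is the root.\<close>

theorem (in free_group) commute_imp_common_root:
  assumes "g \<in> carrier F" "h \<in> carrier F" "g \<otimes> h = h \<otimes> g"
  shows "\<exists>z \<in> carrier F. \<exists>(k::int) (m::int). g = z [^] k \<and> h = z [^] m"
proof (cases "h = \<one>")
  case True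
  then show ?thesis
    using assms(1) by (intro bexI[of _ g] exI[of _ 1] exI[of _ 0]) auto
next
  case False
  then obtain Y w where Y: "free_basis F Y" "cyclically_reduced w" "set w \<subseteq> Y \<times> UNIV" "h = val w"
    using cyclically_reduced_basis assms(2) by blast
  interpret Y: free_group F Y
    by unfold_locales (rule Y(1))
  show ?thesis
    using Y.commute_imp_common_root_cyclically_reduced[OF Y(2,3) assms(1)] assms(3) Y(4) by simp
qed

section \<open>Solvable quotients and the prosolvable topology\<close>

definition finite_solvable_index :: "('a, 'b) monoid_scheme \<Rightarrow> 'a set \<Rightarrow> bool" where
  "finite_solvable_index G N \<longleftrightarrow> N \<lhd> G \<and> finite (rcosets\<^bsub>G\<^esub> N) \<and> solvable (G Mod N)"

text \<open>Here \<open>Q\<close> may have any element type. Being finite it embeds into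
  \<open>nat\<close> by \<open>e\<close>, and its structure is transported to the copy
  \<open>R\<close>, a legitimate target. The condition \<open>sat\<close> says that \<open>S\<close>
  is a union of fibres of \<open>f\<close>, hence the preimage of its own image.\<close>

lemma openin_pro_topology:
  fixes Q :: "('c, 'd) monoid_scheme"
  assumes Q: "group Q" "finite (carrier Q)" "solvable Q"
    and G: "group G" and f: "f \<in> hom G Q" and S: "S \<subseteq> carrier G"
    and sat: "\<And>x y. x \<in> S \<Longrightarrow> y \<in> carrier G \<Longrightarrow> f x = f y \<Longrightarrow> y \<in> S"
  shows "openin (pro_topology finite_solvable_groups G) S"
proof -
  obtain e :: "'c \<Rightarrow> nat" where e: "inj_on e (carrier Q)"
    using finite_imp_inj_to_nat_seg[OF Q(2)] by blast
  define d where "d = inv_into (carrier Q) e"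
  have d: "d (e x) = x" if "x \<in> carrier Q" for x
    using e that by (simp add: d_def)
  define R where "R = \<lparr>carrier = e ` carrier Q, monoid.mult = (\<lambda>a b. e (d a \<otimes>\<^bsub>Q\<^esub> d b)), one = e \<one>\<^bsub>Q\<^esub>\<rparr>"
  interpret Q: group Q by fact
  have e_hom: "e \<in> hom Q R"
    by (auto simp: hom_def R_def d)
  \<comment> \<open>The image of a homomorphism is delivered as a group with overwritten carrier and
    unit; for \<open>R\<close> the overwriting changes nothing.\<close>
  have R_update: "R\<lparr>carrier := e ` carrier Q, one := e \<one>\<^bsub>Q\<^esub>\<rparr> = R"
    by (simp add: R_def)
  have "group R"
    by (rule Q.hom_imp_img_group[OF e_hom, unfolded R_update])
  have R_carrier: "carrier R = e ` carrier Q"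
    by (simp add: R_def)
  have "group_hom Q R e"
    using \<open>group R\<close> e_hom Q.is_group by (intro group_hom.intro group_hom_axioms.intro)
  then have "solvable R"
    unfolding solvable_def R_carrier
    by (rule group_hom.solvable_imp_solvable_img) (rule Q(3)[unfolded solvable_def])
  then have R: "R \<in> finite_solvable_groups"
    using Q(2) \<open>group R\<close> R_carrier by (simp add: finite_solvable_groups_def)
  have comp: "e \<circ> f \<in> hom G R"
    using f e_hom hom_compose by blast
  have "(e \<circ> f) -` ((e \<circ> f) ` S) \<inter> carrier G = S"
  proof
    show "(e \<circ> f) -` ((e \<circ> f) ` S) \<inter> carrier G \<subseteq> S"
    proof clarify
      fix y x assume yx: "y \<in> carrier G" "x \<in> S" "(e \<circ> f) y = (e \<circ> f) x"
      then have "f y \<in> carrier Q" "f x \<in> carrier Q"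
        using S f by (auto simp: hom_def)
      then have "f y = f x"
        using yx(3) e by (simp add: inj_on_eq_iff)
      then show "y \<in> S"
        using sat[OF yx(2,1)] by simp
    qed
  qed (use S in auto)
  moreover have "(e \<circ> f) ` S \<subseteq> carrier R"
    using comp S by (auto simp: hom_def)
  ultimately show ?thesis
    unfolding pro_topology_def using R comp
    by (intro topology_generated_by_Basis, unfold mem_Collect_eq, intro exI conjI[rotated]) auto
qed

lemma (in group) openin_pro_topology_normal:
  assumes N: "finite_solvable_index G N" and S: "S \<subseteq> carrier G"
    and sat: "\<And>x n. x \<in> S \<Longrightarrow> n \<in> N \<Longrightarrow> n \<otimes> x \<in> S"
  shows "openin (pro_topology finite_solvable_groups G) S"
proof (rule openin_pro_topology[of "G Mod N" G "\<lambda>a. N #> a"])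
  interpret normal N G
    using N by (simp add: finite_solvable_index_def)
  show "group (G Mod N)"
    by (rule factorgroup_is_group)
  show "finite (carrier (G Mod N))" "solvable (G Mod N)"
    using N by (simp_all add: finite_solvable_index_def FactGroup_def)
  show "(\<lambda>a. N #> a) \<in> hom G (G Mod N)"
    by (rule r_coset_hom_Mod)
  show "y \<in> S" if "x \<in> S" "y \<in> carrier G" "N #> x = N #> y" for x y
  proof -
    have "y \<in> N #> x"
      using that rcos_self[OF _ is_subgroup] by simp
    then show ?thesis
      using sat that(1) by (auto simp: r_coset_def)
  qed
qed (use S is_group in auto)

text \<open>The space of a generated topology is only the union of the generating sets, so a set
  covering the carrier must be exhibited. The homomorphism to the trivial group provides it.\<close>

lemma topspace_pro_topology:
  assumes "group G"
  shows "topspace (pro_topology finite_solvable_groups G) = carrier G"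
proof
  show "topspace (pro_topology finite_solvable_groups G) \<subseteq> carrier G"
    by (auto simp: pro_topology_def)
  define Q :: "unit monoid" where "Q = \<lparr>carrier = {()}, monoid.mult = (\<lambda>_ _. ()), one = ()\<rparr>"
  have "group Q"
    by (rule groupI) (auto simp: Q_def)
  moreover have "solvable Q"
    using solvable_seq.unity[of Q] by (simp add: solvable_def Q_def)
  ultimately have "openin (pro_topology finite_solvable_groups G) (carrier G)"
    by (intro openin_pro_topology[of Q G "\<lambda>_. ()"]) (auto simp: Q_def hom_def assms)
  then show "carrier G \<subseteq> topspace (pro_topology finite_solvable_groups G)"
    by (rule openin_subset)
qed

text \<open>The derived series of the quotient is the image of that of \<open>G\<close>, so it
  becomes trivial once a term of the latter lies in \<open>N\<close>.\<close>

lemma (in group) finite_solvable_indexI: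
  assumes N: "N \<lhd> G" and fin: "finite (rcosets N)" and D: "(derived G ^^ k) (carrier G) \<subseteq> N"
  shows "finite_solvable_index G N"
proof -
  interpret normal N G by fact
  interpret Q: group "G Mod N"
    by (rule factorgroup_is_group)
  interpret q: group_hom G "G Mod N" "\<lambda>a. N #> a"
    by unfold_locales (rule r_coset_hom_Mod)
  have "(\<lambda>a. N #> a) ` carrier G = carrier (G Mod N)"
    by (auto simp: FactGroup_def RCOSETS_def)
  then have "(derived (G Mod N) ^^ k) (carrier (G Mod N)) = (\<lambda>a. N #> a) ` (derived G ^^ k) (carrier G)"
    using q.exp_of_derived_img[of "carrier G" k] by simp
  also have "\<dots> = {\<one>\<^bsub>G Mod N\<^esub>}"
  proof -
    have "\<one> \<in> (derived G ^^ k) (carrier G)"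
      using exp_of_derived_is_subgroup[OF subgroup_self] subgroup.one_closed by blast
    moreover have "N #> a = N" if "a \<in> N" for a
      using that coset_join2 is_subgroup by auto
    ultimately show ?thesis
      using D by (auto simp: image_iff intro!: bexI[of _ \<one>])
  qed
  finally show ?thesis
    using N fin Q.solvable_iff_trivial_derived_seq by (auto simp: finite_solvable_index_def)
qed

text \<open>Taking \<open>M = 0\<close> shows that the increment of a coordinate only depends on the later coordinates;
  the other values of \<open>M\<close> make the map compatible with reduction modulo \<open>M\<close>.\<close>

definition unitriangular :: "nat \<Rightarrow> ((nat \<Rightarrow> int) \<Rightarrow> nat \<Rightarrow> int) \<Rightarrow> bool" where
  "unitriangular n f \<longleftrightarrow>
     (\<forall>v i. i \<ge> n \<longrightarrow> f v i = v i) \<and>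
     (\<forall>M v v' i. (\<forall>j \<in> {i<..n}. [v j = v' j] (mod M)) \<longrightarrow> [f v i - v i = f v' i - v' i] (mod M))"

lemma unitriangular_cong:
  assumes "unitriangular n f" "\<forall>j \<in> {i..n}. [v j = v' j] (mod M)" "i \<le> n"
  shows "[f v i = f v' i] (mod M)"
proof -
  have "[f v i - v i = f v' i - v' i] (mod M)"
    using assms by (auto simp: unitriangular_def)
  moreover have "[v i = v' i] (mod M)"
    using assms by auto
  ultimately have "[f v i - v i + v i = f v' i - v' i + v' i] (mod M)"
    by (rule cong_add)
  then show ?thesis by simp
qed

lemma unitriangular_id: "unitriangular n id"
  by (simp add: unitriangular_def)

lemma unitriangular_comp:
  assumes f: "unitriangular n f" and g: "unitriangular n g"
  shows "unitriangular n (f \<circ> g)"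
  unfolding unitriangular_def
proof (intro conjI allI impI)
  fix v :: "nat \<Rightarrow> int" and i assume "n \<le> i"
  then show "(f \<circ> g) v i = v i"
    using f g by (simp add: unitriangular_def)
next
  fix M and v v' :: "nat \<Rightarrow> int" and i assume eq: "\<forall>j \<in> {i<..n}. [v j = v' j] (mod M)"
  then have "\<forall>j \<in> {i<..n}. [g v j = g v' j] (mod M)"
    by (auto intro!: unitriangular_cong[OF g])
  then have "[f (g v) i - g v i = f (g v') i - g v' i] (mod M)"
    using f by (auto simp: unitriangular_def)
  moreover have "[g v i - v i = g v' i - v' i] (mod M)"
    using g eq by (auto simp: unitriangular_def)
  ultimately have "[(f (g v) i - g v i) + (g v i - v i) = (f (g v') i - g v' i) + (g v' i - v' i)] (mod M)"
    by (rule cong_add)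
  then show "[(f \<circ> g) v i - v i = (f \<circ> g) v' i - v' i] (mod M)"
    by simp
qed

section \<open>Derived series and congruence quotients of a unitriangular action\<close>

locale unitriangular_action = group G for G :: "('a, 'b) monoid_scheme" (structure) +
  fixes \<phi> :: "'a \<Rightarrow> (nat \<Rightarrow> int) \<Rightarrow> nat \<Rightarrow> int" and n :: nat
  assumes act_one: "\<phi> \<one> = id"
    and act_mult: "\<lbrakk>g \<in> carrier G; h \<in> carrier G\<rbrakk> \<Longrightarrow> \<phi> (g \<otimes> h) = \<phi> g \<circ> \<phi> h"
    and act_unitriangular: "g \<in> carrier G \<Longrightarrow> unitriangular n (\<phi> g)"
begin

text \<open>In matrix terms: the rows from \<open>i\<close> on are those of the identity. For
  decreasing \<open>i\<close> these subgroups form the descending chain that bounds the derived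
  series.\<close>

definition tail_stabilizer :: "nat \<Rightarrow> 'a set" where
  "tail_stabilizer i = {g \<in> carrier G. \<forall>v. \<forall>j \<ge> i. \<phi> g v j = v j}"

definition congruence_kernel :: "int \<Rightarrow> 'a set" where
  "congruence_kernel M = {g \<in> carrier G. \<forall>v i. [\<phi> g v i = v i] (mod M)}"

lemma act_inv: "g \<in> carrier G \<Longrightarrow> \<phi> g (\<phi> (inv g) v) = v"
  using act_mult[of g "inv g"] act_one by (simp add: fun_eq_iff)

lemma subgroup_tail_stabilizer: "subgroup (tail_stabilizer i) G"
proof (rule subgroupI)
  show "inv g \<in> tail_stabilizer i" if "g \<in> tail_stabilizer i" for g
  proof -
    have "\<phi> (inv g) v j = v j" if "j \<ge> i" for v j
    proof -
      have "\<phi> g (\<phi> (inv g) v) j = \<phi> (inv g) v j"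
        using that \<open>g \<in> tail_stabilizer i\<close> by (auto simp: tail_stabilizer_def)
      then show ?thesis
        using \<open>g \<in> tail_stabilizer i\<close> by (simp add: act_inv tail_stabilizer_def)
    qed
    then show ?thesis
      using that by (simp add: tail_stabilizer_def)
  qed
  show "tail_stabilizer i \<noteq> {}"
    using act_one by (auto simp: tail_stabilizer_def intro!: exI[of _ \<one>])
qed (auto simp: tail_stabilizer_def act_mult)

text \<open>The increment of coordinate \<open>i\<close> under \<open>f\<close> depends only on
  later coordinates, and \<open>g\<close> does not change those; so for fixed \<open>v\<close> the
  increment is additive.\<close>

lemma increment_mult:
  assumes f: "f \<in> tail_stabilizer (Suc i)" and g: "g \<in> tail_stabilizer (Suc i)"
  shows "\<phi> (f \<otimes> g) v i - v i = (\<phi> f v i - v i) + (\<phi> g v i - v i)"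
proof -
  \<comment> \<open>A congruence modulo 0 is an equality; unitriangularity is applied with this
    modulus.\<close>
  have "\<forall>j \<in> {i<..n}. [\<phi> g v j = v j] (mod 0)"
    using g by (auto simp: tail_stabilizer_def)
  then have "[\<phi> f (\<phi> g v) i - \<phi> g v i = \<phi> f v i - v i] (mod 0)"
    using act_unitriangular[of f] f by (auto simp only: unitriangular_def tail_stabilizer_def)
  then show ?thesis
    using f g by (auto simp: tail_stabilizer_def act_mult)
qed

text \<open>By \<open>increment_mult\<close> the increment at \<open>i\<close> is a homomorphism
  into the abelian group of integers, so it vanishes on commutators.\<close>

lemma derived_tail_stabilizer:
  assumes "K \<subseteq> tail_stabilizer (Suc i)"
  shows "derived G K \<subseteq> tail_stabilizer i"
  unfolding derived_def
proof (rule generate_subgroup_incl[OF _ subgroup_tail_stabilizer], clarify)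
  fix a b assume "a \<in> K" "b \<in> K"
  then have ab: "a \<in> tail_stabilizer (Suc i)" "b \<in> tail_stabilizer (Suc i)"
    using assms by auto
  let ?T = "tail_stabilizer (Suc i)"
  note closed = subgroup.m_closed[OF subgroup_tail_stabilizer[of "Suc i"]]
    subgroup.m_inv_closed[OF subgroup_tail_stabilizer[of "Suc i"]]
  have inv0: "(\<phi> x v i - v i) + (\<phi> (inv x) v i - v i) = 0" if "x \<in> ?T" for x v
  proof -
    have "x \<otimes> inv x = \<one>"
      using that by (simp add: tail_stabilizer_def)
    then show ?thesis
      using increment_mult[OF that closed(2)[OF that], of v] act_one by simp
  qed
  let ?c = "a \<otimes> b \<otimes> inv a \<otimes> inv b"
  have "?c \<in> ?T"
    using ab closed by blast
  moreover have "\<phi> ?c v i = v i" for v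
    using ab increment_mult[of "a \<otimes> b \<otimes> inv a" i "inv b" v] increment_mult[of "a \<otimes> b" i "inv a" v]
      increment_mult[of a i b v] inv0[of a v] inv0[of b v] closed by simp
  moreover have "j = i \<or> Suc i \<le> j" if "i \<le> j" for j
    using that by auto
  ultimately show "?c \<in> tail_stabilizer i"
    unfolding tail_stabilizer_def by blast
qed

lemma exp_of_derived_tail_stabilizer:
  "(derived G ^^ k) (carrier G) \<subseteq> tail_stabilizer (n - k)"
proof (induction k)
  case 0
  then show ?case
    using act_unitriangular by (auto simp: tail_stabilizer_def unitriangular_def)
next
  case (Suc k)
  show ?case
  proof (cases "k < n")
    case True
    then show ?thesis
      using derived_tail_stabilizer[of "(derived G ^^ k) (carrier G)" "n - Suc k"] Suc
      by (simp add: Suc_diff_Suc)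
  next
    \<comment> \<open>Subtraction is truncated: from step \<open>n\<close> on the bound stays at
      \<open>tail_stabilizer 0\<close>, and being a subgroup is enough to contain further
      commutators.\<close>
    case False
    have "(derived G ^^ Suc k) (carrier G) \<subseteq> derived G (tail_stabilizer (n - k))"
      using Suc mono_derived by auto
    also have "\<dots> \<subseteq> tail_stabilizer (n - k)"
      using derived_incl[OF order.refl subgroup_tail_stabilizer] .
    finally show ?thesis
      using False by simp
  qed
qed

lemma act_cong:
  assumes "g \<in> carrier G" "\<And>j. j \<le> n \<Longrightarrow> [v j = v' j] (mod M)" "i \<le> n"
  shows "[\<phi> g v i = \<phi> g v' i] (mod M)"
  using unitriangular_cong[OF act_unitriangular[OF assms(1)]] assms by auto

lemma act_fixes: "g \<in> carrier G \<Longrightarrow> i \<ge> n \<Longrightarrow> \<phi> g v i = v i"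
  using act_unitriangular by (simp add: unitriangular_def)

lemma normal_congruence_kernel: "congruence_kernel M \<lhd> G"
proof -
  have "subgroup (congruence_kernel M) G"
  proof (rule subgroupI)
    show "congruence_kernel M \<noteq> {}"
      using act_one by (auto simp: congruence_kernel_def intro!: exI[of _ \<one>])
    show "inv g \<in> congruence_kernel M" if "g \<in> congruence_kernel M" for g
    proof -
      have "[\<phi> (inv g) v i = v i] (mod M)" for v i
        using that act_inv[of g v] by (auto simp: congruence_kernel_def) (metis cong_sym)
      then show ?thesis
        using that by (simp add: congruence_kernel_def)
    qed
    show "g \<otimes> h \<in> congruence_kernel M"
      if "g \<in> congruence_kernel M" "h \<in> congruence_kernel M" for g h
      using that by (auto simp: congruence_kernel_def act_mult) (metis cong_trans)
  qed (auto simp: congruence_kernel_def)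
  moreover have "g \<otimes> h \<otimes> inv g \<in> congruence_kernel M"
    if g: "g \<in> carrier G" and h: "h \<in> congruence_kernel M" for g h
  proof -
    have "[\<phi> g (\<phi> h (\<phi> (inv g) v)) i = v i] (mod M)" for v i
    proof (cases "i \<le> n")
      case True
      have "[\<phi> g (\<phi> h (\<phi> (inv g) v)) i = \<phi> g (\<phi> (inv g) v) i] (mod M)"
        using h by (intro act_cong[OF g _ True]) (simp add: congruence_kernel_def)
      then show ?thesis
        by (simp add: act_inv g)
    next
      case False
      then show ?thesis
        using g h by (simp add: act_fixes congruence_kernel_def)
    qed
    then show ?thesis
      using g h by (simp add: congruence_kernel_def act_mult)
  qed
  ultimately show ?thesis
    by (simp add: normal_inv_iff)
qed

text \<open>The coset of \<open>g\<close> is determined by the map \<rho>\<open>g\<close> that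
  \<open>g\<close> induces on the finite set \<open>P\<close> of residue vectors, and there are
  finitely many maps from \<open>P\<close> to \<open>P\<close>.\<close>

lemma finite_rcosets_congruence_kernel:
  assumes "M > 0"
  shows "finite (rcosets (congruence_kernel M))"
proof -
  let ?N = "congruence_kernel M"
  interpret normal ?N G
    by (rule normal_congruence_kernel)
  define P where "P = {..n} \<rightarrow>\<^sub>E {0..<M}"
  define \<rho> where "\<rho> = (\<lambda>g. \<lambda>p \<in> P. \<lambda>i \<in> {..n}. \<phi> g p i mod M)"
  have "\<rho> ` carrier G \<subseteq> P \<rightarrow>\<^sub>E P"
    unfolding \<rho>_def image_subset_iff using assms
    by (intro ballI restrict_PiE[THEN iffD2] Pi_I) (auto simp: P_def)
  moreover have "finite (P \<rightarrow>\<^sub>E P)"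
    unfolding P_def by (intro finite_PiE) auto
  ultimately have fin: "finite (\<rho> ` carrier G)"
    by (rule finite_subset)
  have coset: "?N #> g = ?N #> h" if g: "g \<in> carrier G" and h: "h \<in> carrier G" and eq: "\<rho> g = \<rho> h" for g h
  proof -
    have gh: "[\<phi> g u i = \<phi> h u i] (mod M)" for u i
    proof (cases "i \<le> n")
      case True
      define p where "p = (\<lambda>i \<in> {..n}. u i mod M)"
      have p: "p \<in> P"
        using assms by (auto simp: P_def p_def)
      then have "\<rho> g p i = \<rho> h p i"
        using eq by simp
      then have "[\<phi> g p i = \<phi> h p i] (mod M)"
        using p True by (simp add: \<rho>_def cong_def)
      moreover have "[\<phi> g u i = \<phi> g p i] (mod M)" "[\<phi> h p i = \<phi> h u i] (mod M)"
        by (rule act_cong[OF _ _ True]; use g h in \<open>simp add: p_def cong_def\<close>)+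
      ultimately show ?thesis
        by (blast intro: cong_trans)
    next
      case False
      then show ?thesis
        using g h by (simp add: act_fixes)
    qed
    \<comment> \<open>The congruence \<open>gh\<close> is used at the vector that \<open>h\<close>
      maps to \<open>v\<close>.\<close>
    have "[\<phi> (g \<otimes> inv h) v i = v i] (mod M)" for v i
      using gh[of "\<phi> (inv h) v" i] g h by (simp add: act_mult act_inv)
    moreover have "g \<otimes> inv h \<in> carrier G"
      using g h by simp
    ultimately have "g \<otimes> inv h \<in> ?N"
      unfolding congruence_kernel_def by blast
    then have "g \<otimes> inv h \<otimes> h \<in> ?N #> h"
      using h by (intro rcosI subset)
    then have "g \<in> ?N #> h"
      using g h by (simp add: m_assoc)
    then show ?thesis
      by (rule repr_independence[symmetric, OF _ h is_subgroup])
  qed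
  define s where "s = (\<lambda>y. ?N #> inv_into (carrier G) \<rho> y)"
  have "rcosets ?N \<subseteq> s ` \<rho> ` carrier G"
  proof
    fix C assume "C \<in> rcosets ?N"
    then obtain g where g: "g \<in> carrier G" "C = ?N #> g"
      by (auto simp: RCOSETS_def)
    then have "C = s (\<rho> g)"
      unfolding s_def using coset inv_into_into[of "\<rho> g" \<rho> "carrier G"] f_inv_into_f[of "\<rho> g" \<rho> "carrier G"]
      by (metis imageI)
    then show "C \<in> s ` \<rho> ` carrier G"
      using g by blast
  qed
  then show ?thesis
    using fin finite_surj by blast
qed

lemma finite_solvable_index_congruence_kernel:
  assumes "M > 0"
  shows "finite_solvable_index G (congruence_kernel M)"
proof (rule finite_solvable_indexI[OF normal_congruence_kernel finite_rcosets_congruence_kernel[OF assms]])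
  show "(derived G ^^ n) (carrier G) \<subseteq> congruence_kernel M"
    using exp_of_derived_tail_stabilizer[of n] by (auto simp: tail_stabilizer_def congruence_kernel_def)
qed

text \<open>At the last coordinate \<open>i\<close> moved by \<open>z\<close>, the power \<open>z\<^sup>j\<close> adds \<open>j\<close> times the increment \<open>c\<close> of \<open>z\<close>,
  which is visible modulo \<open>m * c\<close> unless \<open>m\<close> divides \<open>j\<close>.\<close>

lemma exists_large_order_quotient:
  assumes z: "z \<in> carrier G" "\<phi> z \<noteq> id" and m: "m > 0"
  shows "\<exists>N. finite_solvable_index G N \<and> (\<forall>j::int. z [^] j \<in> N \<longrightarrow> m dvd j)"
proof -
  let ?P = "\<lambda>i. \<exists>v. \<phi> z v i \<noteq> v i"
  have ex: "\<exists>i. ?P i"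
    using z(2) by (auto simp: fun_eq_iff)
  have bound: "i \<le> n" if "?P i" for i
    using act_fixes[OF z(1)] that by (meson nat_le_linear)
  define i where "i = (GREATEST i. ?P i)"
  have "?P i"
    unfolding i_def using GreatestI_ex_nat[of ?P, OF ex bound] .
  then obtain v where v: "\<phi> z v i \<noteq> v i"
    by blast
  have zT: "z \<in> tail_stabilizer (Suc i)"
  proof -
    have "\<phi> z v j = v j" if "Suc i \<le> j" for v j
      using Greatest_le_nat[of ?P j, OF _ bound] that unfolding i_def by fastforce
    then show ?thesis
      using z(1) by (simp add: tail_stabilizer_def)
  qed
  define c where "c = \<phi> z v i - v i"
  have pT: "z [^] j \<in> tail_stabilizer (Suc i)" for j :: int
    using subgroup_int_pow_closed[OF subgroup_tail_stabilizer zT] .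
  have pow: "\<phi> (z [^] j) v i - v i = j * c" for j :: int
  proof (induction j rule: int_induct[where k = 0])
    case base
    then show ?case by (simp add: act_one)
  next
    case (step1 j)
    have "z [^] (j + 1) = z [^] j \<otimes> z"
      using z(1) by (simp add: int_pow_mult)
    then show ?case
      using step1 increment_mult[OF pT zT, of j v] by (simp add: c_def algebra_simps)
  next
    case (step2 j)
    have "z [^] j = z [^] (j - 1) \<otimes> z"
      using z(1) int_pow_mult[of z "j - 1" 1] by simp
    then show ?case
      using step2 increment_mult[OF pT zT, of "j - 1" v] by (simp add: c_def algebra_simps)
  qed
  have "m dvd j" if "z [^] j \<in> congruence_kernel (m * \<bar>c\<bar>)" for j :: int
  proof -
    have "m * \<bar>c\<bar> dvd \<phi> (z [^] j) v i - v i"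
      using that by (simp add: congruence_kernel_def cong_iff_dvd_diff)
    then have "m * c dvd j * c"
      by (simp add: pow abs_if split: if_splits)
    then show ?thesis
      using v by (simp add: c_def)
  qed
  moreover have "m * \<bar>c\<bar> > 0"
    using v m by (simp add: c_def)
  ultimately show ?thesis
    using finite_solvable_index_congruence_kernel by blast
qed

end

section \<open>Unitriangular representations of free groups\<close>

definition word_action :: "('a \<times> bool \<Rightarrow> 's \<Rightarrow> 's) \<Rightarrow> ('a \<times> bool) list \<Rightarrow> 's \<Rightarrow> 's" where
  "word_action \<alpha> w = foldr (\<lambda>a f. \<alpha> a \<circ> f) w id"

lemma word_action_simps [simp]:
  "word_action \<alpha> [] = id" "word_action \<alpha> (a # w) = \<alpha> a \<circ> word_action \<alpha> w"
  by (simp_all add: word_action_def)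

lemma word_action_append: "word_action \<alpha> (v @ w) = word_action \<alpha> v \<circ> word_action \<alpha> w"
  by (induction v) (simp_all add: comp_assoc)

text \<open>This lets the action of words descend to the free group, whose product is concatenation
  followed by reduction.\<close>

lemma word_action_reduce:
  assumes "\<And>a. \<alpha> a \<circ> \<alpha> (inv_letter a) = id"
  shows "word_action \<alpha> (reduce w) = word_action \<alpha> w"
proof (induction w)
  case (Cons a w)
  have "\<alpha> a (\<alpha> (inv_letter a) v) = v" for v
    using assms[of a] by (metis comp_apply id_apply)
  then show ?case
    using Cons.IH[symmetric] by (auto split: list.split)
qed simp

text \<open>The letter \<open>x\<close> acts as the matrix \<open>I + \<Sum> E\<^sub>i\<^sub>,\<^sub>i\<^sub>+\<^sub>1\<close>, where \<open>i\<close> runs through the positions of \<open>x\<close>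
  in \<open>xs\<close>.\<close>

definition transvection :: "'a list \<Rightarrow> 'a \<times> bool \<Rightarrow> (nat \<Rightarrow> int) \<Rightarrow> nat \<Rightarrow> int" where
  "transvection xs a v i =
     v i + (if i < length xs \<and> xs ! i = fst a then (if snd a then 1 else - 1) * v (Suc i) else 0)"

text \<open>Since equal entries of \<open>xs\<close> are never adjacent, a letter that adds
  coordinate \<open>Suc i\<close> to coordinate \<open>i\<close> leaves coordinate
  \<open>Suc i\<close> alone. In matrix terms the letter is I + E with E squared equal to 0, and I -
  E is its inverse.\<close>

lemma transvection_inverse:
  assumes "distinct_adj xs"
  shows "transvection xs a \<circ> transvection xs (inv_letter a) = id"
  using assms by (auto simp: fun_eq_iff transvection_def inv_letter_def distinct_adj_conv_nth)

lemma unitriangular_transvection: "unitriangular (length xs) (transvection xs a)"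
  by (auto simp: unitriangular_def transvection_def cong_minus_minus_iff)

lemma unitriangular_word_action:
  "unitriangular (length xs) (word_action (transvection xs) w)"
proof (induction w)
  case Nil
  show ?case
    unfolding word_action_simps by (rule unitriangular_id)
next
  case (Cons a w)
  then show ?case
    unfolding word_action_simps by (intro unitriangular_comp unitriangular_transvection)
qed

section \<open>Syllable decompositions and faithfulness\<close>

definition syllable_value :: "('a, 'b) monoid_scheme \<Rightarrow> ('a \<times> int) list \<Rightarrow> 'a" where
  "syllable_value G ss = group_list_prod G (map (\<lambda>(x, e). x [^]\<^bsub>G\<^esub> e) ss)"

lemma syllable_value_simps [simp]:
  "syllable_value G [] = \<one>\<^bsub>G\<^esub>"
  "syllable_value G ((x, e) # ss) = x [^]\<^bsub>G\<^esub> e \<otimes>\<^bsub>G\<^esub> syllable_value G ss"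
  by (simp_all add: syllable_value_def group_list_prod_def)

context free_group
begin

definition representation :: "'a list \<Rightarrow> 'a \<Rightarrow> (nat \<Rightarrow> int) \<Rightarrow> nat \<Rightarrow> int" where
  "representation xs g = word_action (transvection xs) (rword g)"

lemma representation_val:
  assumes "distinct_adj xs" "is_word w"
  shows "representation xs (val w) = word_action (transvection xs) w"
  unfolding representation_def rword_val_reduce[OF assms(2)]
  using word_action_reduce transvection_inverse[OF assms(1)] by blast

lemma unitriangular_representation:
  assumes "distinct_adj xs"
  shows "unitriangular_action F (representation xs) (length xs)"
proof unfold_locales
  show "representation xs \<one> = id"
    by (simp add: representation_def)
  show "representation xs (g \<otimes> h) = representation xs g \<circ> representation xs h"
    if "g \<in> carrier F" "h \<in> carrier F" for g h
  proof -
    have "g \<otimes> h = val (rword g @ rword h)"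
      using that rword by (simp add: val_append)
    then show ?thesis
      using that representation_val[OF assms, of "rword g @ rword h"] rword
      by (simp add: word_action_append) (simp add: representation_def)
  qed
qed (simp add: representation_def unitriangular_word_action)

lemma syllable_value_closed: "fst ` set ss \<subseteq> X \<Longrightarrow> syllable_value F ss \<in> carrier F"
  using basis_carrier by (induction ss) auto

text \<open>A new letter either opens a syllable or is absorbed into the first one, which disappears
  if its exponent becomes 0. The remaining tail still satisfies the adjacency condition.\<close>

lemma exists_syllables:
  assumes "is_word w"
  shows "\<exists>ss. fst ` set ss \<subseteq> X \<and> distinct_adj (map fst ss) \<and> 0 \<notin> snd ` set ss \<and>
    val w = syllable_value F ss"
  using assms
proof (induction w)
  case Nil
  then show ?case by (intro exI[of _ "[]"]) auto
next
  case (Cons a w)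
  then obtain ss where ss: "fst ` set ss \<subseteq> X" "distinct_adj (map fst ss)" "0 \<notin> snd ` set ss"
      "val w = syllable_value F ss"
    by auto
  define e :: int where "e = (if snd a then 1 else - 1)"
  have x: "fst a \<in> X" "fst a \<in> carrier F"
    using Cons.prems basis_carrier by auto
  have a: "letter_value F a = fst a [^] e"
    using x by (simp add: letter_value_def e_def int_pow_neg)
  show ?case
  proof (cases "\<exists>k ss'. ss = (fst a, k) # ss'")
    case True
    then obtain k ss' where ss': "ss = (fst a, k) # ss'"
      by blast
    have "syllable_value F ss' \<in> carrier F"
      using ss(1) ss' syllable_value_closed by auto
    then have v: "val (a # w) = fst a [^] (e + k) \<otimes> syllable_value F ss'"
      using x by (simp add: a ss(4) ss' int_pow_mult m_assoc)
    show ?thesis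
    proof (cases "e + k = 0")
      case True
      then have "val (a # w) = syllable_value F ss'"
        using v \<open>syllable_value F ss' \<in> carrier F\<close> by simp
      then show ?thesis
        using ss ss' by (intro exI[of _ ss']) (auto simp: distinct_adj_Cons)
    next
      case False
      then show ?thesis
        using v ss ss' by (intro exI[of _ "(fst a, e + k) # ss'"]) auto
    qed
  next
    case False
    then have "distinct_adj (fst a # map fst ss)"
      using ss(2) by (cases ss) auto
    then show ?thesis
      using ss x a by (intro exI[of _ "(fst a, e) # ss"]) (auto simp: e_def)
  qed
qed

text \<open>The matrix of \<open>x\<close> is I + E with E squared equal to 0, so its power with
  exponent \<open>e\<close> is I + \<open>e\<close>E. The fact \<open>shift\<close> expresses the
  vanishing square.\<close>

lemma representation_power:
  assumes xs: "distinct_adj xs" and x: "x \<in> X"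
  shows "representation xs (x [^] (e::int)) v i =
    v i + (if i < length xs \<and> xs ! i = x then e * v (Suc i) else 0)"
proof -
  interpret act: unitriangular_action F "representation xs" "length xs"
    by (rule unitriangular_representation[OF xs])
  have xF: "x \<in> carrier F"
    using x basis_carrier by auto
  have letter: "representation xs (letter_value F (x, b)) = transvection xs (x, b)" for b
    using representation_val[OF xs, of "[(x, b)]"] x xF
    by (simp add: letter_value_def split: if_splits)
  have shift: "\<not> (Suc i < length xs \<and> xs ! Suc i = x)" if "i < length xs" "xs ! i = x" for i
    using xs that by (auto simp: distinct_adj_conv_nth)
  show ?thesis
  proof (induction e arbitrary: v i rule: int_induct[where k = 0])
    case base
    then show ?case by (simp add: act.act_one)
  next
    case (step1 e)
    have "x [^] (e + 1) = x [^] e \<otimes> letter_value F (x, True)"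
      using xF by (simp add: int_pow_mult letter_value_def)
    then have "representation xs (x [^] (e + 1)) = representation xs (x [^] e) \<circ> transvection xs (x, True)"
      using letter[of True] act.act_mult xF by (simp add: letter_value_def)
    then show ?case
      using shift[of i] by (auto simp: step1.IH transvection_def algebra_simps)
  next
    case (step2 e)
    have "x [^] (e - 1) = x [^] e \<otimes> letter_value F (x, False)"
      using xF by (simp add: int_pow_diff letter_value_def)
    then have "representation xs (x [^] (e - 1)) = representation xs (x [^] e) \<circ> transvection xs (x, False)"
      using letter[of False] act.act_mult xF by (simp add: letter_value_def)
    then show ?case
      using shift[of i] by (auto simp: step2.IH transvection_def algebra_simps)
  qed
qed

text \<open>For a product of syllables \<open>x\<^sub>i\<^bsup>e\<^sub>i\<^esup>\<close>, the top right corner of the representing matrix is the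
  product of the exponents.\<close>

lemma faithful_representation:
  assumes g: "g \<in> carrier F" "g \<noteq> \<one>"
  shows "\<exists>xs. distinct_adj xs \<and> representation xs g \<noteq> id"
proof -
  obtain ss where ss: "fst ` set ss \<subseteq> X" "distinct_adj (map fst ss)" "0 \<notin> snd ` set ss"
      "g = syllable_value F ss"
    using exists_syllables[of "rword g"] rword[OF g(1)] by metis
  define xs where "xs = map fst ss"
  define n where "n = length ss"
  define \<delta> :: "nat \<Rightarrow> int" where "\<delta> = (\<lambda>i. if i = n then 1 else 0)"
  have xs: "distinct_adj xs"
    using ss(2) by (simp add: xs_def)
  interpret act: unitriangular_action F "representation xs" "length xs"
    by (rule unitriangular_representation[OF xs])
  let ?v = "\<lambda>k. representation xs (syllable_value F (drop k ss)) \<delta>"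
  \<comment> \<open>The syllables are applied from the right to the last unit vector \<delta>. Each
    one moves the front of the vector one place to the left and multiplies the leading entry by its
    nonzero exponent.\<close>
  have "?v k k \<noteq> 0 \<and> (\<forall>j < k. ?v k j = 0)" if "k \<le> n" for k
    using that
  proof (induction rule: inc_induct)
    case base
    then show ?case
      by (simp add: n_def[symmetric] act.act_one) (simp add: \<delta>_def)
  next
    case (step k)
    obtain x e where xe: "ss ! k = (x, e)"
      by fastforce
    have k: "k < length ss"
      using step.hyps by (simp add: n_def)
    then have mem: "(x, e) \<in> set ss"
      using xe nth_mem by metis
    then have x: "x \<in> X" and e: "e \<noteq> 0"
      using ss(1,3) by force+
    have "drop k ss = (x, e) # drop (Suc k) ss"
      using k xe by (metis Cons_nth_drop_Suc)
    moreover have "fst ` set (drop (Suc k) ss) \<subseteq> X"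
      using ss(1) by (meson image_mono order_trans set_drop_subset)
    then have "syllable_value F (drop (Suc k) ss) \<in> carrier F"
      by (rule syllable_value_closed)
    ultimately have "?v k = representation xs (x [^] e) (?v (Suc k))"
      using x basis_carrier by (auto simp: act.act_mult)
    then have "?v k j = ?v (Suc k) j + (if j < length xs \<and> xs ! j = x then e * ?v (Suc k) (Suc j) else 0)" for j
      using representation_power[OF xs x] by simp
    moreover have "xs ! k = x" "k < length xs"
      using xe k by (simp_all add: xs_def)
    ultimately show ?case
      using step.IH e by simp
  qed
  then have "representation xs g \<delta> 0 \<noteq> 0"
    using ss(4) by (metis drop0 le0)
  \<comment> \<open>This makes entry 0 of \<delta> vanish, so that a nonzero value there shows that
    \<delta> is moved.\<close>
  moreover have "n \<noteq> 0"
    using g(2) ss(4) by (auto simp: n_def)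
  ultimately have "representation xs g \<noteq> id"
    by (auto simp: \<delta>_def)
  then show ?thesis
    using xs by blast
qed

lemma exists_large_order_quotient:
  assumes "z \<in> carrier F" "z \<noteq> \<one>" "m > 0"
  shows "\<exists>N. finite_solvable_index F N \<and> (\<forall>j::int. z [^] j \<in> N \<longrightarrow> m dvd j)"
proof -
  obtain xs where xs: "distinct_adj xs" "representation xs z \<noteq> id"
    using faithful_representation assms by blast
  interpret act: unitriangular_action F "representation xs" "length xs"
    by (rule unitriangular_representation[OF xs(1)])
  show ?thesis
    using act.exists_large_order_quotient[OF assms(1) xs(2) assms(3)] .
qed

section \<open>Cyclic subgroups are closed\<close>

text \<open>The product of \<open>N\<close> with the cyclic group is the preimage of the latter's
  image in the quotient by \<open>N\<close>; the claim is thus a separation in a finite solvable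
  quotient.\<close>

lemma separate_from_cyclic:
  assumes g: "g \<in> carrier F" and h: "h \<in> carrier F"
    and ne: "g \<notin> range (\<lambda>j::int. h [^] j)"
  shows "\<exists>N. finite_solvable_index F N \<and> g \<notin> N <#> range (\<lambda>j::int. h [^] j)"
proof (cases "g \<otimes> h = h \<otimes> g")
  case True
  then obtain z k m where z: "z \<in> carrier F" "g = z [^] (k::int)" "h = z [^] (m::int)"
    using commute_imp_common_root g h by blast
  have "z \<noteq> \<one>"
    using ne z(2) by (auto intro: image_eqI[of _ _ 0])
  have ndvd: "\<not> m dvd k"
    using ne z by (auto simp: dvd_def int_pow_pow)
  \<comment> \<open>For \<open>m = 0\<close> the cyclic group is trivial and \<open>k\<close> is
    nonzero; \<open>\<bar>k\<bar> + 1\<close> is too large to divide it.\<close>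
  define M where "M = (if m = 0 then \<bar>k\<bar> + 1 else \<bar>m\<bar>)"
  have "M > 0"
    by (simp add: M_def)
  then obtain N where N: "finite_solvable_index F N" "\<And>j::int. z [^] j \<in> N \<Longrightarrow> M dvd j"
    using exists_large_order_quotient[OF z(1) \<open>z \<noteq> \<one>\<close>] by blast
  interpret normal N F
    using N(1) by (simp add: finite_solvable_index_def)
  have "g \<notin> N <#> range (\<lambda>j::int. h [^] j)"
  proof
    assume "g \<in> N <#> range (\<lambda>j::int. h [^] j)"
    then obtain n j where nj: "n \<in> N" "g = n \<otimes> h [^] (j::int)"
      by (auto simp: set_mult_def)
    then have "n = g \<otimes> inv (h [^] j)"
      using h by (simp add: m_assoc)
    also have "\<dots> = z [^] (k - m * j)"
      using z by (simp add: int_pow_diff int_pow_pow)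
    finally have "M dvd k - m * j"
      using N(2) nj(1) by simp
    show False
    proof (cases "m = 0")
      case True
      then have "\<bar>k\<bar> + 1 dvd k"
        using \<open>M dvd _\<close> by (simp add: M_def)
      then have "k = 0"
        using dvd_imp_le_int[of k "\<bar>k\<bar> + 1"] by auto
      then show False
        using ndvd True by simp
    next
      case False
      then have "m dvd k - m * j"
        using \<open>M dvd _\<close> by (simp add: M_def)
      then show False
        using ndvd by (simp add: dvd_diff_left_iff)
    qed
  qed
  then show ?thesis
    using N(1) by blast
next
  case False
  define c where "c = g \<otimes> h \<otimes> inv g \<otimes> inv h"
  have "c \<in> carrier F"
    using g h by (simp add: c_def)
  moreover have "c \<noteq> \<one>"
  proof
    assume "c = \<one>"
    have "inv h \<otimes> (h \<otimes> g) = g"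
      using g h by (simp add: m_assoc[symmetric])
    then have "c \<otimes> (h \<otimes> g) = g \<otimes> h"
      using g h by (simp add: c_def m_assoc)
    then show False
      using \<open>c = \<one>\<close> False g h by simp
  qed
  \<comment> \<open>Any modulus above 1 would do: 2 does not divide 1, so \<open>c\<close> stays
    outside \<open>N\<close>.\<close>
  ultimately obtain N where N: "finite_solvable_index F N" "\<And>j::int. c [^] j \<in> N \<Longrightarrow> 2 dvd j"
    using exists_large_order_quotient[of c 2] by auto
  interpret normal N F
    using N(1) by (simp add: finite_solvable_index_def)
  \<comment> \<open>Otherwise \<open>g\<close> is a power of \<open>h\<close> modulo
    \<open>N\<close>, so the two commute there and the commutator \<open>c\<close> falls into
    \<open>N\<close>.\<close>
  have "g \<notin> N <#> range (\<lambda>j::int. h [^] j)"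
  proof
    assume "g \<in> N <#> range (\<lambda>j::int. h [^] j)"
    then obtain n j where nj: "n \<in> N" "g = n \<otimes> h [^] (j::int)"
      by (auto simp: set_mult_def)
    have n: "n \<in> carrier F"
      using nj(1) subset by auto
    have "h [^] j \<otimes> h = h \<otimes> h [^] j"
      using h int_pow_mult[of h j 1] int_pow_mult[of h 1 j] by (simp add: add.commute)
    then have "g \<otimes> h = n \<otimes> h \<otimes> h [^] j"
      using h n nj(2) by (simp add: m_assoc)
    then have "c = n \<otimes> h \<otimes> h [^] j \<otimes> (inv (h [^] j) \<otimes> inv n) \<otimes> inv h"
      using h n by (simp add: c_def nj(2) inv_mult_group)
    also have "\<dots> = n \<otimes> (h \<otimes> inv n \<otimes> inv h)"
    proof -
      have "h [^] j \<otimes> (inv (h [^] j) \<otimes> inv n) = inv n"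
        using h n by (simp add: m_assoc[symmetric])
      then show ?thesis
        using h n by (simp add: m_assoc)
    qed
    finally have "c \<in> N"
      using nj(1) h by (simp add: inv_op_closed2)
    then show False
      using N(2)[of 1] \<open>c \<in> carrier F\<close> by simp
  qed
  then show ?thesis
    using N(1) by blast
qed

text \<open>The witness is the product of a separating \<open>N\<close> with the cyclic group. It
  and its complement are unions of cosets of \<open>N\<close>, so both are open.\<close>

lemma exists_clopen_overgroup:
  assumes g: "g \<in> carrier F" and h: "h \<in> carrier F"
    and ne: "g \<notin> range (\<lambda>j::int. h [^] j)"
  defines "T \<equiv> pro_topology finite_solvable_groups F"
  shows "\<exists>K. subgroup K F \<and> openin T K \<and> closedin T K \<and> range (\<lambda>j::int. h [^] j) \<subseteq> K \<and> g \<notin> K"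
proof -
  let ?H = "range (\<lambda>j::int. h [^] j)"
  obtain N where N: "finite_solvable_index F N" "g \<notin> N <#> ?H"
    using separate_from_cyclic[OF g h ne] by blast
  then have norm: "N \<lhd> F"
    by (simp add: finite_solvable_index_def)
  interpret normal N F by (rule norm)
  let ?K = "N <#> ?H"
  have H: "subgroup ?H F"
    using h generate_pow[of h] generate_is_subgroup[of "{h}"] by (simp add: full_SetCompr_eq)
  have K: "subgroup ?K F"
    by (rule mult_norm_subgroup[OF norm H])
  have "N \<subseteq> ?K"
  proof
    fix x assume x: "x \<in> N"
    then have "x = x \<otimes> h [^] (0::int)"
      using subset by auto
    with x show "x \<in> ?K"
      unfolding set_mult_def by blast
  qed
  then have sat: "n \<otimes> x \<in> ?K \<longleftrightarrow> x \<in> ?K" if "x \<in> carrier F" "n \<in> N" for x n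
  proof -
    have n: "n \<in> ?K" "n \<in> carrier F"
      using that \<open>N \<subseteq> ?K\<close> subset by auto
    show ?thesis
    proof
      assume "n \<otimes> x \<in> ?K"
      then have "inv n \<otimes> (n \<otimes> x) \<in> ?K"
        using n K by (simp add: subgroup.m_closed subgroup.m_inv_closed)
      then show "x \<in> ?K"
        using n that by (simp add: m_assoc[symmetric])
    qed (use n K in \<open>simp add: subgroup.m_closed\<close>)
  qed
  have "openin T ?K"
    unfolding T_def
    by (rule openin_pro_topology_normal[OF N(1)]) (use K sat in \<open>auto simp: subgroup.mem_carrier dest: subgroup.subset\<close>)
  moreover have "openin T (carrier F - ?K)"
    unfolding T_def
    by (rule openin_pro_topology_normal[OF N(1)]) (use sat subset in auto)
  then have "closedin T ?K"
    using K by (simp add: closedin_def T_def topspace_pro_topology subgroup.subset)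
  moreover have "?H \<subseteq> ?K"
    using h by (auto simp: set_mult_def intro!: bexI[of _ \<one>] one_closed) (metis int_pow_closed l_one one_closed)
  ultimately show ?thesis
    using K N(2) by blast
qed

end

section \<open>Free factors by ping-pong\<close>

lemma free_product_words_Nil [simp]: "[] \<in> free_product_words G H L"
  by (simp add: free_product_words_def)

lemma free_product_words_Cons:
  "(t, x) # w \<in> free_product_words G H L \<longleftrightarrow>
     x \<in> (if t then H else L) \<and> x \<noteq> \<one>\<^bsub>G\<^esub> \<and> w \<in> free_product_words G H L \<and>
     (w = [] \<or> fst (hd w) \<noteq> t)"
  by (auto simp: free_product_words_def successively_Cons)

text \<open>Membership of a product in \<open>A\<close> tells from which factor its first syllable
  comes (\<open>inA\<close>). The trivial element lies outside \<open>A\<close>, so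
  \<open>LA\<close> says nothing about words of a single syllable from \<open>L\<close>;
  \<open>LA0\<close> covers them.\<close>

lemma (in group) internal_free_product_ping_pong:
  assumes H: "subgroup H G" and L: "subgroup L G" and K: "subgroup K G"
    and sub: "H \<subseteq> K" "L \<subseteq> K" and gen: "K \<subseteq> generate G (H \<union> L)"
    and HA: "\<And>h g. \<lbrakk>h \<in> H; h \<noteq> \<one>; g \<in> carrier G; g \<notin> A\<rbrakk> \<Longrightarrow> h \<otimes> g \<in> A"
    and LA: "\<And>l g. \<lbrakk>l \<in> L; l \<noteq> \<one>; g \<in> carrier G; g \<in> A\<rbrakk> \<Longrightarrow> l \<otimes> g \<notin> A"
    and LA0: "L \<inter> A = {}"
  shows "internal_free_product G H L K"
proof -
  let ?W = "free_product_words G H L"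
  define pv where "pv = (\<lambda>w :: (bool \<times> 'a) list. group_list_prod G (map snd w))"
  have pv_Nil [simp]: "pv [] = \<one>" and pv_Cons [simp]: "pv ((t, x) # w) = x \<otimes> pv w"
    for t :: bool and x w
    by (simp_all add: pv_def group_list_prod_def)
  have factor: "x \<in> carrier G" if "x \<in> (if t then H else L)" for t x
    using that subgroup.mem_carrier[OF H] subgroup.mem_carrier[OF L] by (auto split: if_splits)
  have closed [simp]: "pv w \<in> carrier G" if "w \<in> ?W" for w
    using that
  proof (induction w)
    case (Cons s w)
    then show ?case
      using factor[of "snd s" "fst s"] by (cases s) (simp add: free_product_words_Cons)
  qed simp
  have inA: "pv w \<in> A \<longleftrightarrow> w \<noteq> [] \<and> fst (hd w)" if "w \<in> ?W" for w
    using that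
  proof (induction w)
    case Nil
    then show ?case
      using LA0 subgroup.one_closed[OF L] by auto
  next
    case (Cons s w)
    obtain t x where s: "s = (t, x)" by fastforce
    have w: "x \<in> (if t then H else L)" "x \<noteq> \<one>" "w \<in> ?W" "w = [] \<or> fst (hd w) \<noteq> t"
      using Cons.prems by (simp_all add: s free_product_words_Cons)
    show ?case
    proof (cases t)
      case True
      then have "pv w \<notin> A"
        using Cons.IH w by auto
      then show ?thesis
        using HA[of x "pv w"] w True s by simp
    next
      case False
      then have "x \<in> L"
        using w by simp
      moreover have "x \<otimes> pv w \<notin> A"
      proof (cases "w = []")
        case True
        then show ?thesis
          using \<open>x \<in> L\<close> LA0 subgroup.mem_carrier[OF L] by auto
      next
        case False
        then have "pv w \<in> A"
          using Cons.IH w \<open>\<not> t\<close> by auto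
        then show ?thesis
          using LA \<open>x \<in> L\<close> w by simp
      qed
      ultimately show ?thesis
        using False s by simp
    qed
  qed
  have LW: "w = []" if "w \<in> ?W" "pv w \<in> L" "w = [] \<or> fst (hd w)" for w
    using inA that LA0 by blast
  have ne_one: "x \<otimes> pv w \<noteq> \<one>" if "(t, x) # w \<in> ?W" for t x w
  proof
    assume eq: "x \<otimes> pv w = \<one>"
    have w: "x \<in> (if t then H else L)" "x \<noteq> \<one>" "w \<in> ?W" "w = [] \<or> fst (hd w) \<noteq> t"
      using that by (simp_all add: free_product_words_Cons)
    have "\<one> \<notin> A"
      using inA[of "[]"] by simp
    then have "\<not> t"
      using inA[OF that] eq by simp
    then have x: "x \<in> L" and hd: "w = [] \<or> fst (hd w)"
      using w by simp_all
    have xG: "x \<in> carrier G"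
      by (rule subgroup.mem_carrier[OF L x])
    have "pv w = inv x"
      using inv_unique'[OF xG closed[OF w(3)] eq inv_comm[OF eq xG closed[OF w(3)]]] .
    then have "w = []"
      using LW[OF w(3) _ hd] subgroup.m_inv_closed[OF L x] by simp
    then show False
      using eq w(2) xG by simp
  qed
  have inj: "v = w" if "v \<in> ?W" "w \<in> ?W" "pv v = pv w" for v w
    using that
  proof (induction v arbitrary: w)
    case Nil
    show ?case
    proof (cases w)
      case (Cons s w')
      then have "pv w \<noteq> \<one>"
        using ne_one[of "fst s" "snd s" w'] Nil.prems(2) by (cases s) simp
      then show ?thesis
        using Nil.prems(3) by simp
    qed simp
  next
    case (Cons s v)
    obtain t x where s: "s = (t, x)" by fastforce
    have v: "x \<in> (if t then H else L)" "x \<noteq> \<one>" "v \<in> ?W" "v = [] \<or> fst (hd v) \<noteq> t"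
      using Cons.prems(1) by (simp_all add: s free_product_words_Cons)
    have "w \<noteq> []"
      using ne_one[of t x v] Cons.prems(1,3) s by auto
    then obtain t' y w' where w': "w = (t', y) # w'"
      by (metis list.exhaust surj_pair)
    have w: "y \<in> (if t' then H else L)" "y \<noteq> \<one>" "w' \<in> ?W" "w' = [] \<or> fst (hd w') \<noteq> t'"
      using Cons.prems(2) by (simp_all add: w' free_product_words_Cons)
    have "t' = t"
      using inA[OF Cons.prems(1)] inA[OF Cons.prems(2)] Cons.prems(3) s w' by auto
    note w = w[unfolded this]
    have xy: "x \<in> carrier G" "y \<in> carrier G"
      using v(1) w(1) factor by auto
    \<comment> \<open>The first syllables come from the same factor, and \<open>z\<close> measures
      their difference. If it were nontrivial, \<open>z\<close> times the rest of one word would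
      equal the rest of the other, which \<open>inA\<close> rules out.\<close>
    define z where "z = inv y \<otimes> x"
    have z: "z \<in> (if t then H else L)"
      using v(1) w(1) H L by (auto simp: z_def subgroup.m_closed subgroup.m_inv_closed)
    have "x \<otimes> pv v = y \<otimes> pv w'"
      using Cons.prems(3) s w' by simp
    then have eq: "z \<otimes> pv v = pv w'"
      using xy v(3) w(3) by (simp add: z_def m_assoc inv_solve_left')
    have "z = \<one>"
    proof (rule ccontr)
      assume z1: "z \<noteq> \<one>"
      show False
      proof (cases t)
        case True
        then have "pv v \<notin> A" "pv w' \<notin> A"
          using inA v w by auto
        then show False
          using HA[of z "pv v"] z z1 True eq v(3) by simp
      next
        case False
        then have zL: "z \<in> L"
          using z by simp
        show False
        proof (cases "v = []")
          case True
          then have "pv w' = z"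
            using eq factor[OF z] by simp
          then have "w' = []"
            using LW[OF w(3)] w(4) zL False by auto
          then show False
            using \<open>pv w' = z\<close> z1 by simp
        next
          case False
          then have "pv v \<in> A"
            using inA v \<open>\<not> t\<close> by auto
          then have "pv w' \<notin> A"
            using LA[of z "pv v"] zL z1 eq v(3) by simp
          then have "w' = []"
            using inA w \<open>\<not> t\<close> by auto
          then have "z \<otimes> pv v = \<one>"
            using eq by simp
          then have "pv v = inv z"
            using inv_unique'[OF factor[OF z] closed[OF v(3)]] inv_comm factor[OF z] closed[OF v(3)] by metis
          then have "pv v \<in> L"
            using zL subgroup.m_inv_closed[OF L] by simp
          then show False
            using \<open>pv v \<in> A\<close> LA0 by auto
        qed
      qed
    qed
    then have "x = y"
      using xy by (metis inv_closed inv_equality inv_inv z_def)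
    moreover have "pv v = pv w'"
      using eq \<open>z = \<one>\<close> v(3) by simp
    ultimately show ?case
      using Cons.IH[of w'] v w s w' \<open>t' = t\<close> by simp
  qed
  \<comment> \<open>Multiplying by an element of a factor opens a new syllable, merges with the
    first one or cancels it; hence the values of words are stable under the generated
    subgroup.\<close>
  have extend: "\<exists>w' \<in> ?W. pv w' = x \<otimes> pv w" if x: "x \<in> (if t then H else L)" and w: "w \<in> ?W" for t x w
  proof (cases "x = \<one> \<or> w = [] \<or> fst (hd w) \<noteq> t")
    case True
    show ?thesis
    proof (cases "x = \<one>")
      case True
      then show ?thesis using w by (intro bexI[of _ w]) auto
    next
      case False
      then show ?thesis
        using x w True by (intro bexI[of _ "(t, x) # w"]) (simp_all add: free_product_words_Cons)
    qed
  next
    case False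
    then obtain y v where w': "w = (t, y) # v"
      by (cases w) auto
    then have v: "y \<in> (if t then H else L)" "v \<in> ?W" "v = [] \<or> fst (hd v) \<noteq> t"
      using w by (simp_all add: free_product_words_Cons)
    have xy: "x \<otimes> y \<in> (if t then H else L)"
      using x v(1) H L by (auto simp: subgroup.m_closed)
    have eq: "x \<otimes> pv w = x \<otimes> y \<otimes> pv v"
      using w' v factor[OF x] factor[OF v(1)] by (simp add: m_assoc)
    show ?thesis
    proof (cases "x \<otimes> y = \<one>")
      case True
      then show ?thesis
        using eq v by (intro bexI[of _ v]) simp_all
    next
      case False
      then show ?thesis
        using eq v xy by (intro bexI[of _ "(t, x \<otimes> y) # v"]) (simp_all add: free_product_words_Cons)
    qed
  qed
  have carrierHL: "H \<union> L \<subseteq> carrier G"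
    using H L by (simp add: subgroup.subset)
  have gen_words: "\<exists>w' \<in> ?W. pv w' = g \<otimes> pv w" if "g \<in> generate G (H \<union> L)" "w \<in> ?W" for g w
    using that
  proof (induction arbitrary: w rule: generate.induct)
    case one
    then show ?case by (intro bexI[of _ w]) auto
  next
    case (incl x)
    then show ?case
      using extend[of x "x \<in> H" w] by auto
  next
    case (inv x)
    then show ?case
      using extend[of "inv x" "x \<in> H" w] subgroup.m_inv_closed[OF H] subgroup.m_inv_closed[OF L] by auto
  next
    case (eng x y)
    have "x \<in> carrier G" "y \<in> carrier G"
      using eng.hyps generate_in_carrier[OF carrierHL] by auto
    then show ?case
      using eng.IH eng.prems by (metis closed m_assoc)
  qed
  have "pv ` ?W = K"
  proof
    show "pv ` ?W \<subseteq> K"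
    proof
      fix g assume "g \<in> pv ` ?W"
      then obtain w where "w \<in> ?W" "g = pv w" by blast
      moreover have "pv w \<in> K" if "w \<in> ?W" for w
        using that
        by (induction w)
           (use K sub in \<open>auto simp: free_product_words_Cons subgroup.one_closed
             intro!: subgroup.m_closed split: if_splits\<close>)
      ultimately show "g \<in> K" by simp
    qed
    show "K \<subseteq> pv ` ?W"
    proof
      fix g assume "g \<in> K"
      then obtain w where "w \<in> ?W" "pv w = g \<otimes> pv []"
        using gen_words[of g "[]"] gen by auto
      then show "g \<in> pv ` ?W"
        using subgroup.mem_carrier[OF K \<open>g \<in> K\<close>] by auto
    qed
  qed
  moreover have "inj_on pv ?W"
    using inj by (auto simp: inj_on_def)
  ultimately show ?thesis
    using H L K by (simp add: internal_free_product_def bij_betw_def pv_def)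
qed

text \<open>In the Schreier graph of \<open>K\<close>, the word \<open>p @ [a]\<close> labels a simple cycle at the base point, whose
  last edge is labelled \<open>a\<close>. The predicate \<open>off_edge g b\<close> says that the edge labelled \<open>b\<close> at the
  vertex \<open>K g\<close> is neither this last edge nor its inverse. The complementary factor consists of the loops that avoid this edge.\<close>

locale simple_cycle = free_group F X for F :: "('a, 'b) monoid_scheme" (structure) and X +
  fixes K :: "'a set" and p :: "('a \<times> bool) list" and a :: "'a \<times> bool"
  assumes K: "subgroup K F"
    and cyc: "cyclically_reduced (p @ [a])"
    and word: "is_word (p @ [a])"
    and loop: "val (p @ [a]) \<in> K"
    and end_simple: "i < length p \<Longrightarrow> val (take i p) \<otimes> inv (val p) \<notin> K"
    and start_simple: "0 < i \<Longrightarrow> i < length p \<Longrightarrow> val (take i p) \<notin> K"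
begin

definition off_edge :: "'a \<Rightarrow> 'a \<times> bool \<Rightarrow> bool" where
  "off_edge g b \<longleftrightarrow> \<not> (g \<otimes> inv (val p) \<in> K \<and> b = a) \<and> \<not> (g \<in> K \<and> b = inv_letter a)"

text \<open>The word is read as a path in the Schreier graph that starts at the vertex
  \<open>K g\<close>.\<close>

primrec avoids :: "'a \<Rightarrow> ('a \<times> bool) list \<Rightarrow> bool" where
  "avoids g [] \<longleftrightarrow> True"
| "avoids g (b # w) \<longleftrightarrow> off_edge g b \<and> avoids (g \<otimes> letter_value F b) w"

definition complement :: "'a set" where
  "complement = {g \<in> K. avoids \<one> (rword g)}"

definition cycle :: 'a where
  "cycle = val (p @ [a])"

lemmas letter_closed = letter_value_closed[OF basis_carrier]

lemma word_p: "is_word p" and letter_a: "a \<in> X \<times> UNIV"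
  using word by auto

lemma K_carrier: "g \<in> K \<Longrightarrow> g \<in> carrier F"
  using K by (rule subgroup.mem_carrier)

lemma K_mult_iff: "k \<in> K \<Longrightarrow> g \<in> carrier F \<Longrightarrow> k \<otimes> g \<in> K \<longleftrightarrow> g \<in> K"
proof
  assume k: "k \<in> K" and g: "g \<in> carrier F" and "k \<otimes> g \<in> K"
  then have "inv k \<otimes> (k \<otimes> g) \<in> K"
    using K by (simp add: subgroup.m_closed subgroup.m_inv_closed)
  then show "g \<in> K"
    using k g K_carrier by (simp add: m_assoc[symmetric])
qed (use K in \<open>simp add: subgroup.m_closed\<close>)

lemma K_mult_iff': "k \<in> K \<Longrightarrow> g \<in> carrier F \<Longrightarrow> g \<otimes> k \<in> K \<longleftrightarrow> g \<in> K"
proof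
  assume k: "k \<in> K" and g: "g \<in> carrier F" and "g \<otimes> k \<in> K"
  then have "(g \<otimes> k) \<otimes> inv k \<in> K"
    using K by (simp add: subgroup.m_closed subgroup.m_inv_closed)
  then show "g \<in> K"
    using k g K_carrier by (simp add: m_assoc)
qed (use K in \<open>simp add: subgroup.m_closed\<close>)

lemma cycle_in: "cycle \<in> K"
  using loop by (simp add: cycle_def)

lemma cycle_closed: "cycle \<in> carrier F"
  by (rule K_carrier[OF cycle_in])

lemma cycle_eq: "cycle = val p \<otimes> letter_value F a"
  using val_append[of p "[a]"] word letter_closed[OF letter_a] by (simp add: cycle_def)

lemma a_eq: "letter_value F a = inv (val p) \<otimes> cycle"
  using letter_closed[OF letter_a] word_p by (simp add: cycle_eq m_assoc[symmetric])

text \<open>As \<open>cycle\<close> lies in \<open>K\<close>, the removed edge ends at the base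
  point; its reverse is therefore the edge \<open>inv_letter a\<close> there, and crossing does not
  depend on the direction of travel.\<close>

lemma off_edge_inverse:
  assumes g: "g \<in> carrier F" and b: "b \<in> X \<times> UNIV"
  shows "off_edge (g \<otimes> letter_value F b) (inv_letter b) \<longleftrightarrow> off_edge g b"
proof -
  have pF: "val p \<in> carrier F"
    using word_p by simp
  consider "b = a" | "b = inv_letter a" | "b \<noteq> a" "b \<noteq> inv_letter a"
    by blast
  then show ?thesis
  proof cases
    case 1
    have "g \<otimes> letter_value F a = (g \<otimes> inv (val p)) \<otimes> cycle"
      using g pF cycle_closed by (simp add: a_eq m_assoc)
    then have "g \<otimes> letter_value F a \<in> K \<longleftrightarrow> g \<otimes> inv (val p) \<in> K"
      using K_mult_iff'[OF cycle_in, of "g \<otimes> inv (val p)"] g pF by simp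
    then show ?thesis
      using 1 by (simp add: off_edge_def)
  next
    case 2
    have "(g \<otimes> inv (letter_value F a)) \<otimes> inv (val p) = g \<otimes> inv cycle"
      using g pF letter_closed[OF letter_a] by (simp add: cycle_eq m_assoc inv_mult_group)
    moreover have "inv cycle \<in> K"
      using K cycle_in by (rule subgroup.m_inv_closed)
    ultimately have "(g \<otimes> inv (letter_value F a)) \<otimes> inv (val p) \<in> K \<longleftrightarrow> g \<in> K"
      using K_mult_iff' g by simp
    then show ?thesis
      using 2 letter_a by (simp add: off_edge_def letter_value_inv[OF basis_carrier])
  next
    case 3
    then show ?thesis
      by (auto simp: off_edge_def inv_letter_eq_iff)
  qed
qed

section \<open>Paths that avoid the removed edge\<close>

lemma avoids_append:
  assumes "g \<in> carrier F" "is_word u" "is_word v"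
  shows "avoids g (u @ v) \<longleftrightarrow> avoids g u \<and> avoids (g \<otimes> val u) v"
  using assms
  by (induction u arbitrary: g) (auto simp: letter_closed m_assoc)

lemma avoids_shift:
  assumes "k \<in> K" "g \<in> carrier F" "is_word w"
  shows "avoids (k \<otimes> g) w \<longleftrightarrow> avoids g w"
  using assms(2,3)
proof (induction w arbitrary: g)
  case (Cons b w)
  have k: "k \<in> carrier F"
    using assms(1) K_carrier by blast
  have "off_edge (k \<otimes> g) b \<longleftrightarrow> off_edge g b"
    using K_mult_iff[OF assms(1)] Cons.prems word_p k by (simp add: off_edge_def m_assoc)
  moreover have "k \<otimes> g \<otimes> letter_value F b = k \<otimes> (g \<otimes> letter_value F b)"
    using Cons.prems k letter_closed by (simp add: m_assoc)
  ultimately show ?case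
    using Cons letter_closed[of b] by simp
qed simp

text \<open>Deleting a backtrack only removes edges, and the rest of the path starts at the same
  vertex as before.\<close>

lemma avoids_reduce:
  assumes "g \<in> carrier F" "is_word w" "avoids g w"
  shows "avoids g (reduce w)"
  using assms
proof (induction w arbitrary: g)
  case (Cons b w)
  then have b: "b \<in> X \<times> UNIV" "letter_value F b \<in> carrier F" and off: "off_edge g b"
    using letter_closed[of b] by auto
  have IH: "avoids (g \<otimes> letter_value F b) (reduce w)"
    using Cons b by simp
  show ?case
  proof (cases "reduce w")
    case Nil
    then show ?thesis using off by simp
  next
    case (Cons c v)
    show ?thesis
    proof (cases "c = inv_letter b")
      case True
      have "g \<otimes> letter_value F b \<otimes> inv (letter_value F b) = g"
        using \<open>g \<in> carrier F\<close> b by (simp add: m_assoc)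
      then have "avoids g v"
        using IH Cons True b by (simp add: letter_value_inv[OF basis_carrier])
      then show ?thesis
        using Cons True by simp
    next
      case False
      then show ?thesis
        using IH Cons off by simp
    qed
  qed
qed simp

lemma avoids_inv_word:
  assumes "g \<in> carrier F" "is_word w" "avoids g w"
  shows "avoids (g \<otimes> val w) (inv_word w)"
  using assms
proof (induction w arbitrary: g)
  case (Cons b w)
  then have b: "b \<in> X \<times> UNIV" "letter_value F b \<in> carrier F" and off: "off_edge g b"
    and w: "is_word w"
    using letter_closed[of b] by auto
  let ?g = "g \<otimes> letter_value F b"
  have "avoids (?g \<otimes> val w) (inv_word w)"
    using Cons b by simp
  moreover have "?g \<otimes> val w \<otimes> val (inv_word w) = ?g"
    using Cons.prems(1) b w by (simp add: val_inv_word m_assoc)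
  moreover have "off_edge ?g (inv_letter b)"
    using off_edge_inverse off Cons.prems(1) b by simp
  ultimately have "avoids (?g \<otimes> val w) (inv_word w @ [inv_letter b])"
    using Cons.prems(1) b w by (simp add: avoids_append)
  then show ?case
    using Cons.prems(1) b w by (simp add: m_assoc)
qed simp

text \<open>A forward crossing would need the end vertex of \<open>p\<close> too early. A backward
  one would start at the base point, which \<open>p\<close> leaves only with its first letter, and
  this is not \<open>inv_letter a\<close> by cyclic reducedness.\<close>

lemma avoids_take: "i \<le> length p \<Longrightarrow> avoids \<one> (take i p)"
proof (induction i)
  case (Suc i)
  then have i: "i < length p" by simp
  have t: "is_word (take i p)" "p ! i \<in> X \<times> UNIV"
    using word_p i nth_mem[OF i] by (auto dest: in_set_takeD)
  have "off_edge (val (take i p)) (p ! i)"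
  proof (cases "i = 0")
    case True
    then have "p ! i \<noteq> inv_letter a"
      using cyc i by (auto simp: cyclically_reduced_def hd_conv_nth nth_append)
    then show ?thesis
      using end_simple[OF i] by (simp add: off_edge_def)
  next
    case False
    then show ?thesis
      using end_simple[OF i] start_simple[OF _ i] by (simp add: off_edge_def)
  qed
  then show ?case
    using Suc i t by (simp add: take_Suc_conv_app_nth avoids_append)
qed simp

lemma avoids_p: "avoids \<one> p"
  using avoids_take[of "length p"] by simp

lemma in_complementI:
  assumes "is_word w" "avoids \<one> w" "val w \<in> K"
  shows "val w \<in> complement"
  using assms avoids_reduce by (simp add: complement_def rword_val_reduce)

lemma subgroup_complement: "subgroup complement F"
proof (rule subgroupI)
  show "complement \<subseteq> carrier F"
    using K_carrier by (auto simp: complement_def)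
  show "complement \<noteq> {}"
    using K subgroup.one_closed by (auto simp: complement_def intro!: exI[of _ \<one>])
  show "inv g \<in> complement" if "g \<in> complement" for g
  proof -
    have g: "g \<in> K" "avoids \<one> (rword g)" "g \<in> carrier F"
      using that K_carrier by (auto simp: complement_def)
    note r = rword[OF g(3)]
    have "avoids (g \<otimes> \<one>) (inv_word (rword g))"
      using avoids_inv_word[OF one_closed r(2) g(2)] r(3) g(3) by simp
    then have "avoids \<one> (inv_word (rword g))"
      using avoids_shift[OF g(1) one_closed, of "inv_word (rword g)"] r(2) by simp
    moreover have "val (inv_word (rword g)) = inv g"
      using r by (simp add: val_inv_word)
    ultimately show ?thesis
      using in_complementI[of "inv_word (rword g)"] r(2) K g(1) by (simp add: subgroup.m_inv_closed)
  qed
  show "g \<otimes> h \<in> complement" if "g \<in> complement" "h \<in> complement" for g h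
  proof -
    have gh: "g \<in> K" "avoids \<one> (rword g)" "g \<in> carrier F" "h \<in> K" "avoids \<one> (rword h)" "h \<in> carrier F"
      using that K_carrier by (auto simp: complement_def)
    have "avoids (g \<otimes> \<one>) (rword h)"
      using avoids_shift[OF gh(1) one_closed] rword(2)[OF gh(6)] gh(5) by simp
    then have "avoids \<one> (rword g @ rword h)"
      using gh rword by (simp add: avoids_append)
    moreover have "val (rword g @ rword h) = g \<otimes> h"
      using gh rword by (simp add: val_append)
    ultimately show ?thesis
      using in_complementI[of "rword g @ rword h"] rword gh K by (simp add: subgroup.m_closed)
  qed
qed

text \<open>Together with \<open>starts_backward\<close> this is the ping-pong set: the reduced path
  runs along the cycle, in one of its two directions, up to and including its first crossing of the
  removed edge.\<close>

definition starts_forward :: "'a \<Rightarrow> bool" where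
  "starts_forward g \<longleftrightarrow> (\<exists>r. rword g = p @ a # r)"

definition starts_backward :: "'a \<Rightarrow> bool" where
  "starts_backward g \<longleftrightarrow> (\<exists>r. rword g = inv_letter a # r)"

text \<open>Needed to iterate: after one multiplication by \<open>cycle\<close> or its inverse, the
  next one again meets its hypothesis.\<close>

lemma not_starts_both: "\<not> (starts_forward g \<and> starts_backward g)"
proof
  assume "starts_forward g \<and> starts_backward g"
  then obtain r s where "p @ a # r = inv_letter a # s"
    unfolding starts_forward_def starts_backward_def by metis
  then have "hd (p @ [a]) = inv_letter a"
    by (cases p) auto
  then show False
    using cyc by (simp add: cyclically_reduced_def)
qed

lemma starts_forward_mult:
  assumes g: "g \<in> carrier F" "\<not> starts_backward g"
  shows "starts_forward (cycle \<otimes> g)"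
proof -
  note r = rword[OF g(1)]
  have "rword g = [] \<or> hd (rword g) \<noteq> inv_letter a"
    using g(2) by (cases "rword g") (auto simp: starts_backward_def)
  then have "reduced ((p @ [a]) @ rword g)"
    using r(1) cyc by (subst reduced_append) (auto simp: cyclically_reduced_def)
  moreover have "val ((p @ [a]) @ rword g) = cycle \<otimes> g"
    using word r by (simp only: val_append cycle_def)
  moreover have "is_word ((p @ [a]) @ rword g)"
    using word r by simp
  ultimately have "rword (cycle \<otimes> g) = (p @ [a]) @ rword g"
    using rword_val by metis
  then show ?thesis
    by (simp add: starts_forward_def)
qed

text \<open>The inverse cycle may cancel partly against \<open>g\<close>, but completely only if
  \<open>g\<close> begins with \<open>p @ [a]\<close>; so its leading letter
  \<open>inv_letter a\<close> survives.\<close>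

lemma starts_backward_mult:
  assumes g: "g \<in> carrier F" "\<not> starts_forward g"
  shows "starts_backward (inv cycle \<otimes> g)"
proof -
  note r = rword[OF g(1)]
  have red: "reduced (inv_word (p @ [a]))"
    using cyc by (intro reduced_inv_word) (simp add: cyclically_reduced_def)
  obtain u c v where c: "inv_word (p @ [a]) = u @ c" "rword g = inv_word c @ v" "reduced (u @ v)"
    by (rule reduced_cancellation[OF red r(1)])
  have "u \<noteq> []"
  proof
    assume "u = []"
    then have "c = inv_word (p @ [a])"
      using c(1) by simp
    then have "inv_word c = p @ [a]"
      by (metis inv_word_simps(4))
    then have "rword g = p @ a # v"
      using c(2) by simp
    then show False
      using g(2) by (simp add: starts_forward_def)
  qed
  then have u: "u = inv_letter a # tl u"
    using c(1) by (cases u) auto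
  have w: "is_word (inv_word (p @ [a]))"
    using word by (simp only: set_inv_word)
  have "is_word (u @ v)"
    using w r(2) unfolding c(1,2) by simp
  moreover have "val (u @ v) = inv cycle \<otimes> g"
    using val_cancellation[of u c v] w r(2,3) val_inv_word[OF word]
    unfolding c(1,2) cycle_def by simp
  ultimately have "rword (inv cycle \<otimes> g) = u @ v"
    using c(3) rword_val by metis
  then show ?thesis
    using u unfolding starts_backward_def by (metis append_Cons)
qed

lemma cycle_nat_pow_mult:
  assumes "g \<in> carrier F" "\<not> starts_backward g"
  shows "starts_forward (cycle [^] Suc m \<otimes> g)"
proof (induction m)
  case 0
  then show ?case
    using starts_forward_mult assms cycle_closed by simp
next
  case (Suc m)
  have "cycle [^] Suc (Suc m) \<otimes> g = cycle \<otimes> (cycle [^] Suc m \<otimes> g)"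
    using cycle_closed assms(1) nat_pow_Suc2[OF cycle_closed, of "Suc m"] by (metis m_assoc nat_pow_closed)
  moreover have "cycle [^] Suc m \<otimes> g \<in> carrier F"
    using cycle_closed assms(1) by simp
  ultimately show ?case
    using starts_forward_mult not_starts_both Suc by metis
qed

lemma inv_cycle_nat_pow_mult:
  assumes "g \<in> carrier F" "\<not> starts_forward g"
  shows "starts_backward (inv cycle [^] Suc m \<otimes> g)"
proof (induction m)
  case 0
  then show ?case
    using starts_backward_mult assms cycle_closed by simp
next
  case (Suc m)
  have "inv cycle [^] Suc (Suc m) \<otimes> g = inv cycle \<otimes> (inv cycle [^] Suc m \<otimes> g)"
    using cycle_closed assms(1) nat_pow_Suc2[of "inv cycle" "Suc m"] by (metis inv_closed m_assoc nat_pow_closed)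
  moreover have "inv cycle [^] Suc m \<otimes> g \<in> carrier F"
    using cycle_closed assms(1) by simp
  ultimately show ?case
    using starts_backward_mult not_starts_both Suc by metis
qed

lemma cycle_int_pow_mult:
  assumes g: "g \<in> carrier F" "\<not> starts_forward g" "\<not> starts_backward g" and j: "j \<noteq> 0"
  shows "starts_forward (cycle [^] (j::int) \<otimes> g) \<or> starts_backward (cycle [^] j \<otimes> g)"
proof (cases "j > 0")
  case True
  then obtain m where "j = int (Suc m)"
    by (metis Suc_pred' zero_less_imp_eq_int of_nat_0_less_iff)
  then have "cycle [^] j = cycle [^] Suc m"
    by (simp only: int_pow_int)
  then show ?thesis
    using cycle_nat_pow_mult[OF g(1,3), of m] by simp
next
  case False
  then obtain m where m: "j = - int (Suc m)"
    using j by (metis int_cases nat.exhaust of_nat_0 zero_less_Suc of_nat_0_less_iff neg_0_equal_iff_equal)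
  have "cycle [^] j = inv cycle [^] Suc m"
    using cycle_closed unfolding m by (simp only: int_pow_neg int_pow_int nat_pow_inv inv_closed)
  then show ?thesis
    using inv_cycle_nat_pow_mult[OF g(1,2), of m] by simp
qed

text \<open>The path to the first crossing in \<open>g\<close> is \<open>p\<close> or empty.
  Multiplication by \<open>l\<close> replaces it by a different reduced path \<open>q\<close> to the
  same vertex that still avoids the edge, so the crossing is no longer reached along the
  cycle.\<close>

lemma complement_mult:
  assumes l: "l \<in> complement" "l \<noteq> \<one>" and g: "g \<in> carrier F" and gA: "starts_forward g \<or> starts_backward g"
  shows "\<not> starts_forward (l \<otimes> g) \<and> \<not> starts_backward (l \<otimes> g)"
proof -
  have lK: "l \<in> K" "avoids \<one> (rword l)" "l \<in> carrier F"
    using l(1) K_carrier by (auto simp: complement_def)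
  have pF: "val p \<in> carrier F"
    using word_p by simp
  have cross: False if "avoids \<one> (u @ b # v)" "is_word (u @ b # v)" "\<not> off_edge (val u) b" for u b v
    using that avoids_append[of \<one> u "b # v"] by auto
  have off1: "\<not> off_edge \<one> (inv_letter a)"
    using K subgroup.one_closed by (auto simp: off_edge_def)
  have offp: "\<not> off_edge (val p) a"
    using K subgroup.one_closed pF by (auto simp: off_edge_def)
  have ne_backward: False if "avoids \<one> q" "is_word q" "q = inv_letter a # s" for q s
    using cross[of "[]" "inv_letter a" s] that off1 by auto
  show ?thesis
  proof (cases "starts_forward g")
    case True
    then obtain r where r: "rword g = p @ a # r"
      by (auto simp: starts_forward_def)
    define q where "q = rword (l \<otimes> val p)"
    have q: "reduced q" "is_word q" "val q = l \<otimes> val p"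
      using rword[of "l \<otimes> val p"] lK pF by (simp_all add: q_def)
    have qa: "avoids \<one> q"
    proof -
      have "avoids (l \<otimes> \<one>) p"
        using avoids_shift[OF lK(1) one_closed word_p] avoids_p by simp
      then have "avoids \<one> (rword l @ p)"
        using lK rword[OF lK(3)] word_p by (simp add: avoids_append)
      moreover have "val (rword l @ p) = l \<otimes> val p"
        using rword[OF lK(3)] word_p by (simp add: val_append)
      then have "q = reduce (rword l @ p)"
        using rword_val_reduce[of "rword l @ p"] rword[OF lK(3)] word_p by (simp add: q_def)
      ultimately show ?thesis
        using avoids_reduce[of \<one> "rword l @ p"] rword[OF lK(3)] word_p by simp
    qed
    have "q \<noteq> p"
      using q(3) l(2) lK(3) pF by (metis r_cancel_one)
    have offq: "\<not> off_edge (val q) a"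
      using lK pF by (simp add: off_edge_def q(3) m_assoc)
    have "reduced (a # r)" "is_word (a # r)"
      using rword[OF g] r by (auto simp: reduced_append)
    \<comment> \<open>Since \<open>q\<close> ends where the removed edge begins, a last letter
      \<open>inv_letter a\<close> would mean that \<open>q\<close> has just crossed this edge
      backwards.\<close>
    have "q = [] \<or> a \<noteq> inv_letter (last q)"
    proof (rule ccontr)
      assume "\<not> ?thesis"
      then have ne: "q \<noteq> []" "last q = inv_letter a"
        by auto
      then have qb: "q = butlast q @ [inv_letter a]"
        by (metis append_butlast_last_id)
      then have wb: "is_word (butlast q)"
        using q(2) by (auto dest: in_set_butlastD)
      have "off_edge (val (butlast q)) (inv_letter a)"
        using cross[of "butlast q" "inv_letter a" "[]"] qa q(2) qb by metis
      then have "off_edge (val (butlast q) \<otimes> letter_value F (inv_letter a)) (inv_letter (inv_letter a))"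
        using off_edge_inverse[of "val (butlast q)" "inv_letter a"] wb letter_a by simp
      moreover have "val q = val (butlast q) \<otimes> letter_value F (inv_letter a)"
        using val_append[of "butlast q" "[inv_letter a]"] wb letter_a qb letter_closed[of "inv_letter a"] by simp
      ultimately show False
        using offq by simp
    qed
    then have "reduced (q @ a # r)"
      using q(1) \<open>reduced (a # r)\<close> by (simp add: reduced_append)
    moreover have "val (q @ a # r) = l \<otimes> g"
    proof -
      have "val (q @ a # r) = l \<otimes> (val p \<otimes> val (a # r))"
        using q \<open>is_word (a # r)\<close> lK pF val_append[of q "a # r"] letter_closed[of a] by (simp add: m_assoc)
      also have "val p \<otimes> val (a # r) = g"
        using val_append[OF word_p \<open>is_word (a # r)\<close>] rword[OF g] r by simp
      finally show ?thesis .
    qed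
    moreover have wq: "is_word (q @ a # r)"
      using q(2) \<open>is_word (a # r)\<close> by simp
    ultimately have lg: "rword (l \<otimes> g) = q @ a # r"
      using rword_val by metis
    have "\<not> starts_forward (l \<otimes> g)"
    proof
      assume "starts_forward (l \<otimes> g)"
      then obtain s where "q @ a # r = p @ a # s"
        using lg by (auto simp: starts_forward_def)
      \<comment> \<open>Of \<open>q\<close> and \<open>p\<close>, which are distinct, the longer one
        would continue the shorter one with the letter \<open>a\<close> and thereby cross the edge;
        both avoid it.\<close>
      then obtain us where "(q = p @ us \<and> us @ a # r = a # s) \<or> (q @ us = p \<and> a # r = us @ a # s)"
        by (auto simp: append_eq_append_conv2)
      then show False
      proof (elim disjE conjE)
        assume "q = p @ us" "us @ a # r = a # s"
        then obtain us' where "q = p @ a # us'"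
          using \<open>q \<noteq> p\<close> by (cases us) auto
        then show False
          using cross[of p a us'] qa q(2) offp by simp
      next
        assume "q @ us = p" "a # r = us @ a # s"
        then obtain us' where "p = q @ a # us'"
          using \<open>q \<noteq> p\<close> by (cases us) auto
        then show False
          using cross[of q a us'] avoids_p word_p offq by simp
      qed
    qed
    moreover have "\<not> starts_backward (l \<otimes> g)"
      using lg ne_backward[OF qa q(2)] by (cases q) (auto simp: starts_backward_def)
    ultimately show ?thesis by blast
  next
    case False
    then obtain r where r: "rword g = inv_letter a # r"
      using gA by (auto simp: starts_backward_def)
    let ?b = "inv_letter a"
    define q where "q = rword l"
    have q: "reduced q" "is_word q" "val q = l" "avoids \<one> q"
      using rword[OF lK(3)] lK(2) by (simp_all add: q_def)
    have "q \<noteq> []"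
      using q(3) l(2) by auto
    have offq: "\<not> off_edge (val q) ?b"
      using lK by (simp add: off_edge_def q(3))
    have "reduced (?b # r)" "is_word (?b # r)"
      using rword[OF g] r by auto
    have "last q \<noteq> a"
    proof
      assume ne: "last q = a"
      then have qb: "q = butlast q @ [a]"
        using \<open>q \<noteq> []\<close> by (metis append_butlast_last_id)
      then have wb: "is_word (butlast q)"
        using q(2) by (auto dest: in_set_butlastD)
      have "off_edge (val (butlast q)) a"
        using cross[of "butlast q" a "[]"] q(2,4) qb by metis
      then have "off_edge (val (butlast q) \<otimes> letter_value F a) ?b"
        using off_edge_inverse[of "val (butlast q)" a] wb letter_a by simp
      moreover have "val q = val (butlast q) \<otimes> letter_value F a"
        using val_append[of "butlast q" "[a]"] wb letter_a qb letter_closed[of a] by simp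
      ultimately show False
        using offq by simp
    qed
    then have "reduced (q @ ?b # r)"
      using q(1) \<open>reduced (?b # r)\<close> by (simp add: reduced_append inv_letter_eq_iff)
    moreover have "val (q @ ?b # r) = l \<otimes> g"
      using val_append[OF q(2) \<open>is_word (?b # r)\<close>] rword(3)[OF g] r q(3) by simp
    moreover have wq: "is_word (q @ ?b # r)"
      using q(2) \<open>is_word (?b # r)\<close> by simp
    ultimately have lg: "rword (l \<otimes> g) = q @ ?b # r"
      using rword_val by metis
    have "\<not> starts_forward (l \<otimes> g)"
    proof
      assume "starts_forward (l \<otimes> g)"
      then obtain s where "q @ ?b # r = p @ a # s"
        using lg by (auto simp: starts_forward_def)
      then obtain us where "(q = p @ us \<and> us @ ?b # r = a # s) \<or> (q @ us = p \<and> ?b # r = us @ a # s)"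
        by (auto simp: append_eq_append_conv2)
      then show False
      proof (elim disjE conjE)
        assume "q = p @ us" "us @ ?b # r = a # s"
        then obtain us' where "q = p @ a # us'"
          by (cases us) auto
        then show False
          using cross[of p a us'] q(2,4) offp by simp
      next
        assume "q @ us = p" "?b # r = us @ a # s"
        then obtain us' where "p = q @ ?b # us'"
          by (cases us) auto
        then show False
          using cross[of q ?b us'] avoids_p word_p offq by simp
      qed
    qed
    moreover have "\<not> starts_backward (l \<otimes> g)"
      using lg ne_backward[OF q(4,2)] \<open>q \<noteq> []\<close> by (cases q) (auto simp: starts_backward_def)
    ultimately show ?thesis by blast
  qed
qed

lemma complement_not_starts:
  assumes "l \<in> complement"
  shows "\<not> starts_forward l \<and> \<not> starts_backward l"
proof -
  have l: "avoids \<one> (rword l)" "is_word (rword l)"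
    using assms K_carrier rword by (auto simp: complement_def)
  have "\<not> off_edge \<one> (inv_letter a)" "\<not> off_edge (val p) a"
    using K subgroup.one_closed word_p by (auto simp: off_edge_def)
  then show ?thesis
    using l avoids_append[of \<one> p "a # _"] by (auto simp: starts_forward_def starts_backward_def)
qed

text \<open>The loop is cut at its crossings: \<open>q\<close> is the part since the last crossing
  and \<open>r\<close> is still to be read. At a crossing \<open>q\<close> is closed up to an
  element of the complement, and a factor \<open>cycle\<close> or its inverse is split off.\<close>

lemma generated_by_complement:
  assumes "is_word q" "is_word r" "avoids \<one> q" "val q \<otimes> val r \<in> K"
  shows "val q \<otimes> val r \<in> generate F (range (\<lambda>j::int. cycle [^] j) \<union> complement)"
  using assms(2,1,3,4)
proof (induction r arbitrary: q)
  case Nil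
  then show ?case
    using in_complementI[of q] by (auto intro: generate.incl)
next
  case (Cons b r)
  let ?S = "generate F (range (\<lambda>j::int. cycle [^] j) \<union> complement)"
  have b: "b \<in> X \<times> UNIV" "letter_value F b \<in> carrier F" and r: "is_word r"
    using Cons.prems letter_closed[of b] by auto
  have qF: "val q \<in> carrier F" "val r \<in> carrier F" "val p \<in> carrier F"
    using Cons.prems r word_p by auto
  have cyc_gen: "cycle \<in> ?S" "inv cycle \<in> ?S"
  proof -
    have "cycle = cycle [^] (1::int)" "inv cycle = cycle [^] (- 1::int)"
      using cycle_closed by (simp_all add: int_pow_neg)
    then show "cycle \<in> ?S" "inv cycle \<in> ?S"
      by (metis UnI1 generate.incl rangeI)+
  qed
  have compl_gen: "g \<in> ?S" if "g \<in> complement" for g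
    using that by (simp add: generate.incl)
  show ?case
  proof (cases "off_edge (val q) b")
    case True
    have "val (q @ [b]) = val q \<otimes> letter_value F b"
      using val_append[of q "[b]"] Cons.prems b by simp
    moreover have "avoids \<one> (q @ [b])"
      using avoids_append[of \<one> q "[b]"] True Cons.prems b by simp
    moreover have "is_word (q @ [b])"
      using Cons.prems by simp
    ultimately show ?thesis
      using Cons.IH[OF r, of "q @ [b]"] Cons.prems qF b by (simp add: m_assoc)
  next
    case False
    show ?thesis
    proof (cases "b = a")
      case True
      then have qp: "val q \<otimes> inv (val p) \<in> K"
        using False by (auto simp: off_edge_def)
      have "val (q @ inv_word p) = val q \<otimes> inv (val p)"
        using val_append[of q "inv_word p"] Cons.prems word_p by (simp add: val_inv_word)
      moreover have "avoids (val q) (inv_word p)"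
      proof -
        have "avoids (\<one> \<otimes> val p) (inv_word p)"
          using avoids_inv_word[OF one_closed word_p avoids_p] .
        then have "avoids ((val q \<otimes> inv (val p)) \<otimes> val p) (inv_word p)"
          using avoids_shift[OF qp, of "val p" "inv_word p"] word_p qF by simp
        then show ?thesis
          using qF by (simp add: m_assoc)
      qed
      then have "avoids \<one> (q @ inv_word p)"
        using avoids_append[of \<one> q "inv_word p"] Cons.prems word_p by simp
      ultimately have c: "val q \<otimes> inv (val p) \<in> complement"
        using in_complementI[of "q @ inv_word p"] qp Cons.prems word_p by simp
      have eq: "val q \<otimes> val (b # r) = (val q \<otimes> inv (val p)) \<otimes> cycle \<otimes> val r"
        using qF cycle_closed True by (simp add: a_eq m_assoc)
      have "(val q \<otimes> inv (val p)) \<otimes> cycle \<in> K"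
        using qp cycle_in K by (simp add: subgroup.m_closed)
      then have "val r \<in> K"
        using Cons.prems(4) K_mult_iff[of "(val q \<otimes> inv (val p)) \<otimes> cycle" "val r"] qF by (simp only: eq)
      then have "val r \<in> ?S"
        using Cons.IH[OF r, of "[]"] qF by simp
      then show ?thesis
        unfolding eq by (rule generate.eng[OF generate.eng[OF compl_gen[OF c] cyc_gen(1)]])
    next
      case False
      then have b': "b = inv_letter a" and qK: "val q \<in> K"
        using \<open>\<not> off_edge (val q) b\<close> by (auto simp: off_edge_def)
      have c: "val q \<in> complement"
        using in_complementI Cons.prems qK by simp
      \<comment> \<open>A backward crossing ends at the end of \<open>p\<close>, so the induction
        restarts with \<open>p\<close> in place of \<open>q\<close>; after a forward crossing it
        restarts with the empty word.\<close>
      have "letter_value F b = inv cycle \<otimes> val p"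
        using b' letter_a letter_closed[OF letter_a] qF cycle_closed
        by (simp add: letter_value_inv[OF basis_carrier] a_eq inv_mult_group)
      then have eq: "val q \<otimes> val (b # r) = val q \<otimes> inv cycle \<otimes> (val p \<otimes> val r)"
        using qF cycle_closed by (simp add: m_assoc)
      have "val q \<otimes> inv cycle \<in> K"
        using qK cycle_in K by (simp add: subgroup.m_closed subgroup.m_inv_closed)
      then have "val p \<otimes> val r \<in> K"
        using Cons.prems(4) K_mult_iff[of "val q \<otimes> inv cycle" "val p \<otimes> val r"] qF by (simp only: eq) simp
      then have "val p \<otimes> val r \<in> ?S"
        using Cons.IH[OF r word_p avoids_p] by simp
      then show ?thesis
        unfolding eq by (rule generate.eng[OF generate.eng[OF compl_gen[OF c] cyc_gen(2)]])
    qed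
  qed
qed

theorem internal_free_product_cycle:
  "internal_free_product F (range (\<lambda>j::int. cycle [^] j)) complement K"
proof (rule internal_free_product_ping_pong[where A = "{g. starts_forward g \<or> starts_backward g}"])
  show "subgroup (range (\<lambda>j::int. cycle [^] j)) F"
    using cycle_closed generate_pow[of cycle] generate_is_subgroup[of "{cycle}"]
    by (simp add: full_SetCompr_eq)
  show "range (\<lambda>j::int. cycle [^] j) \<subseteq> K"
    using subgroup_int_pow_closed[OF K cycle_in] by blast
  show "K \<subseteq> generate F (range (\<lambda>j::int. cycle [^] j) \<union> complement)"
  proof
    fix g assume "g \<in> K"
    then show "g \<in> generate F (range (\<lambda>j::int. cycle [^] j) \<union> complement)"
      using generated_by_complement[of "[]" "rword g"] rword K_carrier by simp
  qed
  show "h \<otimes> g \<in> {g. starts_forward g \<or> starts_backward g}"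
    if h: "h \<in> range (\<lambda>j::int. cycle [^] j)" "h \<noteq> \<one>"
      and g: "g \<in> carrier F" "g \<notin> {g. starts_forward g \<or> starts_backward g}" for h g
  proof -
    obtain j :: int where j: "h = cycle [^] j"
      using h(1) by blast
    then have "j \<noteq> 0"
      using h(2) by auto
    then show ?thesis
      using cycle_int_pow_mult[of g j] g j by simp
  qed
qed (use subgroup_complement K complement_mult complement_not_starts in \<open>auto simp: complement_def\<close>)

end

section \<open>Making the cycle simple, and conclusion\<close>

lemma (in free_group) cyclic_free_factor:
  assumes w: "cyclically_reduced w" "is_word w"
  defines "T \<equiv> pro_topology finite_solvable_groups F"
  shows "\<exists>K. subgroup K F \<and> openin T K \<and> closedin T K \<and> free_factor F (range (\<lambda>j::int. val w [^] j)) K"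
proof -
  let ?H = "range (\<lambda>j::int. val w [^] j)"
  obtain p a where pa: "w = p @ [a]"
    using w(1) by (cases w rule: rev_cases) (auto simp: cyclically_reduced_def)
  have p: "is_word p"
    using w(2) pa by simp
  have tk: "is_word (take i p)" "reduced (take i p)" for i
    using p w(1) reduced_append[of "take i p" "drop i p"]
    by (auto simp: pa cyclically_reduced_def reduced_append dest: in_set_takeD)
  have hd: "take i p = [] \<or> hd (take i p) \<noteq> inv_letter (last w)" for i
    using w(1) by (cases p; cases i) (auto simp: pa cyclically_reduced_def)
  have length_pow: "length (rword (val w [^] n \<otimes> val (take i p))) = n * length w + min i (length p)" for n :: nat and i
  proof -
    have "is_word (word_power w n @ take i p)"
      using set_word_power[of w n] w(2) tk(1)[of i] by auto
    moreover have "val (word_power w n @ take i p) = val w [^] n \<otimes> val (take i p)"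
      using set_word_power[of w n] w(2) tk(1)[of i] val_append[of "word_power w n" "take i p"]
      by (auto simp: val_word_power)
    ultimately have "rword (val w [^] n \<otimes> val (take i p)) = word_power w n @ take i p"
      using reduced_word_power_append[OF w(1) tk(2) hd] rword_val by metis
    then show ?thesis
      by (simp add: min.commute)
  qed
  have wF: "val w \<in> carrier F" and tF: "val (take i p) \<in> carrier F" and pF: "val p \<in> carrier F" for i
    using w(2) tk p by simp_all
  have length_take: "length (rword (val (take i p))) = i" if "i \<le> length p" for i
    using rword_val[OF tk(2,1)] that by simp
  have lw: "length w = Suc (length p)"
    by (simp add: pa)
  have translate_nat: "i = k"
    if "val (take i p) = val w [^] n \<otimes> val (take k p)" "i \<le> length p" "k \<le> length p" for i k n :: nat
  proof -
    have "i = n * Suc (length p) + k"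
      using length_take[OF that(2)] length_pow[of n k] that(3) unfolding that(1) lw by simp
    then show ?thesis
      using that(2) by (cases n) simp_all
  qed
  \<comment> \<open>Proper prefixes of \<open>w\<close> lie in different cosets of the cyclic group:
    multiplying a prefix by a positive power of \<open>val w\<close> makes the reduced word longer
    than any proper prefix, and a negative power is moved to the other side.\<close>
  have translate: "i = k"
    if eq: "val (take i p) = val w [^] (j::int) \<otimes> val (take k p)" and "i \<le> length p" "k \<le> length p" for i j k
  proof (cases j)
    case (nonneg n)
    then show ?thesis
      using translate_nat[of i n k] that by (simp add: int_pow_int)
  next
    case (neg n)
    have "val w [^] (- j) \<otimes> val (take i p) = val (take k p)"
      using wF tF by (simp add: eq int_pow_neg m_assoc[symmetric])
    moreover have "val w [^] (- j) = val w [^] Suc n"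
      unfolding neg minus_minus by (rule int_pow_int)
    ultimately show ?thesis
      using translate_nat[of k "Suc n" i] that by simp
  qed
  \<comment> \<open>Exactly the elements that \<open>end_simple\<close> and
    \<open>start_simple\<close> require to lie outside \<open>K\<close>.\<close>
  define B where "B = (\<lambda>i. val (take i p) \<otimes> inv (val p)) ` {..<length p} \<union> (\<lambda>i. val (take i p)) ` {0<..<length p}"
  have "finite B"
    by (simp add: B_def)
  have B: "b \<in> carrier F \<and> b \<notin> ?H" if bB: "b \<in> B" for b
  proof -
    consider i where "i < length p" "b = val (take i p) \<otimes> inv (val p)"
      | i where "0 < i" "i < length p" "b = val (take i p)"
      using bB by (auto simp: B_def)
    then show ?thesis
    proof cases
      case 1
      have "b \<notin> ?H"
      proof
        assume "b \<in> ?H"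
        then obtain j :: int where "b = val w [^] j" by blast
        then have "val (take i p) = val w [^] j \<otimes> val p"
          using 1(2) tF pF wF by (metis inv_closed inv_solve_right' int_pow_closed)
        then show False
          using translate[of i j "length p"] 1(1) by simp
      qed
      then show ?thesis
        using 1 tF pF by simp
    next
      case 2
      have "b \<notin> ?H"
      proof
        assume "b \<in> ?H"
        then obtain j :: int where "b = val w [^] j" by blast
        then show False
          using translate[of i j 0] 2 wF by simp
      qed
      then show ?thesis
        using 2 tF by simp
    qed
  qed
  have "\<exists>K. subgroup K F \<and> openin T K \<and> closedin T K \<and> ?H \<subseteq> K \<and> b \<notin> K" if "b \<in> B" for b
    using exists_clopen_overgroup[OF _ wF, of b] B[OF that] unfolding T_def by simp
  then have "\<forall>b \<in> B. \<exists>K. subgroup K F \<and> openin T K \<and> closedin T K \<and> ?H \<subseteq> K \<and> b \<notin> K"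
    by simp
  from bchoice[OF this] obtain N where
    N: "\<And>b. b \<in> B \<Longrightarrow> subgroup (N b) F \<and> openin T (N b) \<and> closedin T (N b) \<and> ?H \<subseteq> N b \<and> b \<notin> N b"
    by auto
  \<comment> \<open>\<open>B\<close> is empty when \<open>w\<close> has length 1; inserting the
    carrier keeps the intersection inside \<open>F\<close>.\<close>
  define \<K> where "\<K> = insert (carrier F) (N ` B)"
  have \<K>: "subgroup M F \<and> openin T M \<and> closedin T M \<and> ?H \<subseteq> M" if "M \<in> \<K>" for M
    using that N subgroup_self wF openin_topspace[of T] closedin_topspace[of T]
    by (auto simp: \<K>_def T_def topspace_pro_topology[OF is_group])
  have fin: "finite \<K>" "\<K> \<noteq> {}"
    using \<open>finite B\<close> by (simp_all add: \<K>_def)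
  let ?K = "\<Inter>\<K>"
  have K: "subgroup ?K F"
    using subgroups_Inter[of \<K>] \<K> fin(2) by blast
  have HK: "?H \<subseteq> ?K"
    using \<K> by blast
  have notB: "b \<notin> ?K" if "b \<in> B" for b
    using that N by (auto simp: \<K>_def)
  interpret simple_cycle F X ?K p a
  proof (intro simple_cycle.intro simple_cycle_axioms.intro)
    show "free_group F X"
      by (rule free_group_axioms)
    show "subgroup ?K F"
      by (rule K)
    show "cyclically_reduced (p @ [a])" "is_word (p @ [a])"
      using w by (simp_all only: pa)
    show "val (p @ [a]) \<in> ?K"
      using HK int_pow_1[OF wF] rangeI[of "\<lambda>j::int. val w [^] j" 1] unfolding pa by auto
    show "val (take i p) \<otimes> inv (val p) \<notin> ?K" if "i < length p" for i
      by (rule notB) (use that in \<open>auto simp: B_def\<close>)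
    show "val (take i p) \<notin> ?K" if "0 < i" "i < length p" for i
      by (rule notB) (use that in \<open>auto simp: B_def\<close>)
  qed
  have "free_factor F ?H ?K"
    using internal_free_product_cycle by (auto simp: free_factor_def cycle_def pa)
  moreover have "openin T ?K"
    using openin_Inter[OF fin] \<K> by blast
  moreover have "closedin T ?K"
    using closedin_Inter[OF fin(2)] \<K> by blast
  ultimately show ?thesis
    using K by blast
qed

text \<open>Ping-pong with the empty set: the trivial factor has no element to play.\<close>

lemma (in group) free_factor_trivial: "free_factor G {\<one>} (carrier G)"
  unfolding free_factor_def
proof
  show "internal_free_product G {\<one>} (carrier G) (carrier G)"
    by (rule internal_free_product_ping_pong[where A = "{}"])
       (auto simp: triv_subgroup subgroup_self intro: generate.incl)
qed

theorem corollary3p4: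
  fixes F :: "('a, 'b) monoid_scheme" and H :: "'a set"
  assumes "is_free_group F"
    and "subgroup H F"
    and "cyclic_group (F\<lparr>carrier := H\<rparr>)"
  shows "closedin (pro_topology finite_solvable_groups F) H \<and>
    (\<exists>K. subgroup K F \<and>
         openin (pro_topology finite_solvable_groups F) K \<and>
         closedin (pro_topology finite_solvable_groups F) K \<and>
         free_factor F H K)"
proof -
  let ?T = "pro_topology finite_solvable_groups F"
  obtain X where "group F" "free_basis F X"
    using assms(1) by (auto simp: is_free_group_def)
  then interpret free_group F X
    by (simp add: free_group_def free_group_axioms_def)
  have "group (F\<lparr>carrier := H\<rparr>)"
    using assms(2) by (rule subgroup_imp_group)
  then obtain h where "h \<in> H" and "H = range (\<lambda>j::int. h [^]\<^bsub>F\<lparr>carrier := H\<rparr>\<^esub> j)"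
    using assms(3) by (auto simp: group.cyclic_group)
  then have H: "H = range (\<lambda>j::int. h [^]\<^bsub>F\<^esub> j)"
    using int_pow_consistent[OF assms(2)] by simp
  have h: "h \<in> carrier F"
    using \<open>h \<in> H\<close> assms(2) by (simp add: subgroup.mem_carrier)
  have topspace: "topspace ?T = carrier F"
    by (rule topspace_pro_topology[OF is_group])
  have "closedin ?T H"
  proof -
    define \<K> where "\<K> = {K. closedin ?T K \<and> H \<subseteq> K}"
    have mem: "carrier F \<in> \<K>"
      using topspace closedin_topspace[of ?T] assms(2) by (simp add: \<K>_def subgroup.subset)
    \<comment> \<open>Every point outside \<open>H\<close> is excluded by some clopen subgroup that
      contains \<open>H\<close>.\<close>
    have "H = \<Inter>\<K>"
    proof
      show "\<Inter>\<K> \<subseteq> H"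
      proof
        fix g assume g: "g \<in> \<Inter>\<K>"
        then have "g \<in> carrier F"
          using mem by blast
        then show "g \<in> H"
          using exists_clopen_overgroup[OF _ h, of g] g unfolding H \<K>_def by blast
      qed
    qed (auto simp: \<K>_def)
    moreover have "closedin ?T (\<Inter>\<K>)"
    proof (rule closedin_Inter)
      show "\<K> \<noteq> {}"
        using mem by blast
    qed (simp add: \<K>_def)
    ultimately show ?thesis
      by simp
  qed
  moreover have "\<exists>K. subgroup K F \<and> openin ?T K \<and> closedin ?T K \<and> free_factor F H K"
  proof (cases "h = \<one>\<^bsub>F\<^esub>")
    \<comment> \<open>The identity is the value of no cyclically reduced word, so the trivial
      subgroup is treated apart, with \<open>F\<close> itself as the clopen overgroup.\<close>
    case True
    then have "H = {\<one>\<^bsub>F\<^esub>}"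
      using H by auto
    then show ?thesis
      using free_factor_trivial subgroup_self topspace openin_topspace[of ?T] closedin_topspace[of ?T]
      by auto
  next
    case False
    obtain Y w where Y: "free_basis F Y" "cyclically_reduced w" "set w \<subseteq> Y \<times> UNIV" "h = word_value F w"
      using cyclically_reduced_basis[OF h False] by blast
    interpret Y: free_group F Y
      by unfold_locales (rule Y(1))
    show ?thesis
      using Y.cyclic_free_factor[OF Y(2,3)] unfolding H Y(4) .
  qed
  ultimately show ?thesis ..
qed

end
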